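(* Let $A$ be a category internal to $\mathbf{Pro}$, the category of profinite spaces and continuous maps. If $P\in\mathbf{Grp}(\mathrm{IFun}(A,\mathbf{Pro}))$, then its colimit (internal to $\mathbf{Pro}$) exists and can be constructed using coequalisers and coproducts of shapes $A_0^\delta$ and $A_1^\delta$. In particular, the category $\mathbf{PGrp}$ of profinite groups has all colimits internal to $\mathbf{Pro}$.
   Context: A category $A$ internal to $\mathbf{Pro}$ consists of profinite spaces $A_0$ (objects), $A_1$ (morphisms) and continuous maps $d_0,d_1\colon A_1\to A_0$ (source, target), $i\colon A_0\to A_1$ (identities), $c\colon A_1\times_{A_0}A_1\to A_1$ (composition; pullback along $(d_1,d_0)$) whose underlying sets and functions form an ordinary category. An internal functor $P\colon A\to\mathbf{Pro}$ consists of a profinite space $P_0$ and continuous maps $p_0\colon P_0\to A_0$ and $p_1\colon A_1\times_{A_0}P_0\to P_0$ (pullback along $(d_0,p_0)$) whose underlying sets and functions describe an ordinary functor $A\to\mathbf{Set}$ sending $a\in A_0$ to $P(a)=p_0^{-1}(\{a\})$ and $f\colon a\to b$ in $A_1$ to $P(f)\colon P(a)\to P(b)$, $x\mapsto p_1(f,x)$. An internal natural transformation $P\to Q$ is a continuous map $P_0\to Q_0$ whose underlying function describes an ordinary natural transformation. These form an ordinary category $\mathrm{IFun}(A,\mathbf{Pro})$, which has finite products (computed as fibre products over $A_0$). $\mathbf{Grp}(\mathrm{IFun}(A,\mathbf{Pro}))$ is its category of group objects: an object is an internal functor $P$ with continuous multiplication, inversion and identity maps $P_0\times_{A_0}P_0\to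 P_0$, $P_0\to P_0$, $A_0\to P_0$ over $A_0$ making each $P(a)$ a group and each $P(f)$ a homomorphism; morphisms are internal natural transformations that are homomorphisms on each fibre. $\mathbf{PGrp}$ is the category of profinite groups (group objects in $\mathbf{Pro}$). The functor $\Delta_A\colon\mathbf{PGrp}\to\mathbf{Grp}(\mathrm{IFun}(A,\mathbf{Pro}))$ sends $G$ to the constant internal functor with space $G\times A_0\to A_0$. The colimit of $P$ (internal to $\mathbf{Pro}$) is the reflection of $P$ along $\Delta_A$, if it exists, i.e. a profinite group $C$ with a universal morphism $P\to\Delta_A(C)$. $\mathbf{PGrp}$ has all colimits internal to $\mathbf{Pro}$ if $\Delta_A$ has a left adjoint for every category $A$ internal to $\mathbf{Pro}$. For $X\in\mathbf{Pro}$, the discrete internal category $X^\delta$ has $X^\delta_0=X^\delta_1=X$ and all structure maps identities; $\mathrm{IFun}(X^\delta,\mathbf{Pro})$ is equivalent to the slice category $\mathbf{Pro}_{/X}$. It is known that $\Delta_{X^\delta}$ has a left adjoint, denoted $Q\mapsto\coprod_{x\in X}Q(x)$; its value is called the free profinite product of $Q$, and is the coproduct of shape $X^\delta$ internal to $\mathbf{Pro}$. Coequalisers are ordinary coequalisers in $\mathbf{PGrp}$. *)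

theory Defs
  imports "HOL-Analysis.Analysis" "HOL-Algebra.Group"
begin

section \<open>Profinite spaces and profinite groups\<close>

definition profinite_space :: "'a topology \<Rightarrow> bool" where
  "profinite_space X \<longleftrightarrow>
     compact_space X \<and> Hausdorff_space X \<and>
     (\<forall>S. connectedin X S \<longrightarrow> (\<exists>a. S \<subseteq> {a}))"

definition fibre_product :: "'a topology \<Rightarrow> 'b topology \<Rightarrow> ('a \<Rightarrow> 'c) \<Rightarrow> ('b \<Rightarrow> 'c) \<Rightarrow> ('a \<times> 'b) topology"
  where "fibre_product X Y f g = subtopology (prod_topology X Y) {(x, y). f x = g y}"

record 'a pgrp = "'a monoid" +
  gtop :: "'a topology"

definition profinite_group :: "'a pgrp \<Rightarrow> bool" where
  "profinite_group G \<longleftrightarrow>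
     group G \<and> profinite_space (gtop G) \<and> topspace (gtop G) = carrier G \<and>
     continuous_map (prod_topology (gtop G) (gtop G)) (gtop G) (\<lambda>(x, y). x \<otimes>\<^bsub>G\<^esub> y) \<and>
     continuous_map (gtop G) (gtop G) (\<lambda>x. inv\<^bsub>G\<^esub> x)"

definition pgrp_hom :: "'a pgrp \<Rightarrow> 'b pgrp \<Rightarrow> ('a \<Rightarrow> 'b) \<Rightarrow> bool" where
  "pgrp_hom G H h \<longleftrightarrow> h \<in> hom G H \<and> continuous_map (gtop G) (gtop H) h"


section \<open>Categories internal to profinite spaces\<close>

text \<open>Composition is in diagrammatic order: \<open>cmp A (f, g)\<close> is ``first \<open>f\<close>, then \<open>g\<close>''.\<close>

record ('o, 'm) icat =
  Ob :: "'o topology"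
  Arr :: "'m topology"
  src :: "'m \<Rightarrow> 'o"
  tgt :: "'m \<Rightarrow> 'o"
  idn :: "'o \<Rightarrow> 'm"
  cmp :: "'m \<times> 'm \<Rightarrow> 'm"

definition internal_category :: "('o, 'm) icat \<Rightarrow> bool" where
  "internal_category A \<longleftrightarrow>
     profinite_space (Ob A) \<and> profinite_space (Arr A) \<and>
     continuous_map (Arr A) (Ob A) (src A) \<and>
     continuous_map (Arr A) (Ob A) (tgt A) \<and>
     continuous_map (Ob A) (Arr A) (idn A) \<and>
     continuous_map (fibre_product (Arr A) (Arr A) (tgt A) (src A)) (Arr A) (cmp A) \<and>
     (\<forall>a\<in>topspace (Ob A). src A (idn A a) = a \<and> tgt A (idn A a) = a) \<and>
     (\<forall>f\<in>topspace (Arr A). \<forall>g\<in>topspace (Arr A). tgt A f = src A g \<longrightarrow>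
        src A (cmp A (f, g)) = src A f \<and> tgt A (cmp A (f, g)) = tgt A g) \<and>
     (\<forall>f\<in>topspace (Arr A).
        cmp A (idn A (src A f), f) = f \<and> cmp A (f, idn A (tgt A f)) = f) \<and>
     (\<forall>f\<in>topspace (Arr A). \<forall>g\<in>topspace (Arr A). \<forall>h\<in>topspace (Arr A).
        tgt A f = src A g \<and> tgt A g = src A h \<longrightarrow>
        cmp A (cmp A (f, g), h) = cmp A (f, cmp A (g, h)))"

text \<open>The discrete internal category on a space; its composable pairs form the diagonal.\<close>

definition discrete_icat :: "'x topology \<Rightarrow> ('x, 'x) icat" where
  "discrete_icat X = \<lparr>Ob = X, Arr = X, src = id, tgt = id, idn = id, cmp = fst\<rparr>"


section \<open>Internal functors and their group objects\<close>

record ('o, 'm, 'p) ifun =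
  tot :: "'p topology"
  base :: "'p \<Rightarrow> 'o"
  act :: "'m \<times> 'p \<Rightarrow> 'p"

definition internal_functor :: "('o, 'm) icat \<Rightarrow> ('o, 'm, 'p, 'z) ifun_scheme \<Rightarrow> bool" where
  "internal_functor A P \<longleftrightarrow>
     profinite_space (tot P) \<and>
     continuous_map (tot P) (Ob A) (base P) \<and>
     continuous_map (fibre_product (Arr A) (tot P) (src A) (base P)) (tot P) (act P) \<and>
     (\<forall>f\<in>topspace (Arr A). \<forall>x\<in>topspace (tot P). src A f = base P x \<longrightarrow>
        base P (act P (f, x)) = tgt A f) \<and>
     (\<forall>x\<in>topspace (tot P). act P (idn A (base P x), x) = x) \<and>
     (\<forall>f\<in>topspace (Arr A). \<forall>g\<in>topspace (Arr A). \<forall>x\<in>topspace (tot P).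
        src A f = base P x \<and> tgt A f = src A g \<longrightarrow>
        act P (cmp A (f, g), x) = act P (g, act P (f, x)))"

definition internal_nat_trans ::
  "('o, 'm) icat \<Rightarrow> ('o, 'm, 'p, 'y) ifun_scheme \<Rightarrow> ('o, 'm, 'q, 'z) ifun_scheme \<Rightarrow> ('p \<Rightarrow> 'q) \<Rightarrow> bool"
  where "internal_nat_trans A P Q t \<longleftrightarrow>
     continuous_map (tot P) (tot Q) t \<and>
     (\<forall>x\<in>topspace (tot P). base Q (t x) = base P x) \<and>
     (\<forall>f\<in>topspace (Arr A). \<forall>x\<in>topspace (tot P). src A f = base P x \<longrightarrow>
        t (act P (f, x)) = act Q (f, t x))"

record ('o, 'm, 'p) igrp = "('o, 'm, 'p) ifun" +
  gmul :: "'p \<times> 'p \<Rightarrow> 'p"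
  ginv :: "'p \<Rightarrow> 'p"
  gone :: "'o \<Rightarrow> 'p"

definition fibre :: "('o, 'm, 'p) igrp \<Rightarrow> 'o \<Rightarrow> 'p monoid" where
  "fibre P a = \<lparr>carrier = {x \<in> topspace (tot P). base P x = a},
                mult = (\<lambda>x y. gmul P (x, y)), one = gone P a\<rparr>"

text \<open>Objects and morphisms of the category of group objects in internal functors on \<open>A\<close>.
  Equality of morphisms always means agreement on the underlying space.\<close>

definition group_ifun :: "('o, 'm) icat \<Rightarrow> ('o, 'm, 'p) igrp \<Rightarrow> bool" where
  "group_ifun A P \<longleftrightarrow>
     internal_functor A P \<and>
     continuous_map (fibre_product (tot P) (tot P) (base P) (base P)) (tot P) (gmul P) \<and>
     continuous_map (tot P) (tot P) (ginv P) \<and>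
     continuous_map (Ob A) (tot P) (gone P) \<and>
     (\<forall>a\<in>topspace (Ob A). group (fibre P a)) \<and>
     (\<forall>a\<in>topspace (Ob A). \<forall>x\<in>carrier (fibre P a).
        ginv P x \<in> carrier (fibre P a) \<and> gmul P (ginv P x, x) = gone P a) \<and>
     (\<forall>f\<in>topspace (Arr A).
        (\<lambda>x. act P (f, x)) \<in> hom (fibre P (src A f)) (fibre P (tgt A f)))"

definition group_ifun_mor ::
  "('o, 'm) icat \<Rightarrow> ('o, 'm, 'p) igrp \<Rightarrow> ('o, 'm, 'q) igrp \<Rightarrow> ('p \<Rightarrow> 'q) \<Rightarrow> bool" where
  "group_ifun_mor A P Q t \<longleftrightarrow>
     internal_nat_trans A P Q t \<and>
     (\<forall>a\<in>topspace (Ob A). t \<in> hom (fibre P a) (fibre Q a))"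


section \<open>Constant diagrams and internal colimits\<close>

definition Delta :: "('o, 'm) icat \<Rightarrow> 'g pgrp \<Rightarrow> ('o, 'm, 'g \<times> 'o) igrp" where
  "Delta A G =
     \<lparr>tot = prod_topology (gtop G) (Ob A),
      base = snd,
      act = (\<lambda>(f, (g, a)). (g, tgt A f)),
      gmul = (\<lambda>((g, a), (h, b)). (g \<otimes>\<^bsub>G\<^esub> h, a)),
      ginv = (\<lambda>(g, a). (inv\<^bsub>G\<^esub> g, a)),
      gone = (\<lambda>a. (\<one>\<^bsub>G\<^esub>, a))\<rparr>"

definition Delta_map :: "('g \<Rightarrow> 'h) \<Rightarrow> 'g \<times> 'o \<Rightarrow> 'h \<times> 'o" where
  "Delta_map h = map_prod h id"

text \<open>\<open>is_colimit TYPE('g) A P C \<eta>\<close>: the morphism \<open>\<eta>\<close> from \<open>P\<close> to the constant diagram on \<open>C\<close>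
  is a reflection of \<open>P\<close> along \<open>Delta A\<close>, where universality is tested against all profinite
  groups with elements of type \<open>'g\<close>. HOL has no quantification over types inside a formula, so the
  test type is a parameter. Taking \<open>'g\<close> to be the type \<open>'p ample\<close> below loses nothing: every
  profinite group topologically generated by a continuous image of \<open>P\<close> has at most as many elements
  as \<open>'p ample\<close>, and the universal property only concerns such groups.\<close>

definition is_colimit ::
  "'g itself \<Rightarrow> ('o, 'm) icat \<Rightarrow> ('o, 'm, 'p) igrp \<Rightarrow> 'c pgrp \<Rightarrow> ('p \<Rightarrow> 'c \<times> 'o) \<Rightarrow> bool" where
  "is_colimit U A P C \<eta> \<longleftrightarrow>
     profinite_group C \<and> group_ifun_mor A P (Delta A C) \<eta> \<and>
     (\<forall>(G :: 'g pgrp) \<phi>. profinite_group G \<and> group_ifun_mor A P (Delta A G) \<phi> \<longrightarrow>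
        (\<exists>h. pgrp_hom C G h \<and> (\<forall>x\<in>topspace (tot P). Delta_map h (\<eta> x) = \<phi> x) \<and>
          (\<forall>h'. pgrp_hom C G h' \<and> (\<forall>x\<in>topspace (tot P). Delta_map h' (\<eta> x) = \<phi> x) \<longrightarrow>
             (\<forall>y\<in>carrier C. h' y = h y))))"

type_synonym 'p ample = "'p list set set"

text \<open>The free profinite product of \<open>Q\<close> over \<open>X\<close>, that is, the coproduct of shape the discrete
  category on \<open>X\<close>. The coprojection of \<open>x\<close> is \<open>fst (\<iota> x)\<close>.\<close>

definition is_free_product ::
  "'g itself \<Rightarrow> 'x topology \<Rightarrow> ('x, 'x, 'q) igrp \<Rightarrow> 's pgrp \<Rightarrow> ('q \<Rightarrow> 's \<times> 'x) \<Rightarrow> bool" where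
  "is_free_product U X Q S \<iota> \<longleftrightarrow> is_colimit U (discrete_icat X) Q S \<iota>"

definition is_coequaliser ::
  "'g itself \<Rightarrow> 'r pgrp \<Rightarrow> 's pgrp \<Rightarrow> ('r \<Rightarrow> 's) \<Rightarrow> ('r \<Rightarrow> 's) \<Rightarrow> 'c pgrp \<Rightarrow> ('s \<Rightarrow> 'c) \<Rightarrow> bool" where
  "is_coequaliser U R S u v C q \<longleftrightarrow>
     profinite_group C \<and> pgrp_hom S C q \<and> (\<forall>r\<in>carrier R. q (u r) = q (v r)) \<and>
     (\<forall>(G :: 'g pgrp) k. profinite_group G \<and> pgrp_hom S G k \<and> (\<forall>r\<in>carrier R. k (u r) = k (v r)) \<longrightarrow>
        (\<exists>h. pgrp_hom C G h \<and> (\<forall>s\<in>carrier S. h (q s) = k s) \<and>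
          (\<forall>h'. pgrp_hom C G h' \<and> (\<forall>s\<in>carrier S. h' (q s) = k s) \<longrightarrow>
             (\<forall>y\<in>carrier C. h' y = h y))))"


section \<open>The construction of colimits from free products and coequalisers\<close>

text \<open>The family \<open>a \<mapsto> P(a)\<close> indexed by the space of objects.\<close>

definition ob_family :: "('o, 'm, 'p) igrp \<Rightarrow> ('o, 'o, 'p) igrp" where
  "ob_family P = \<lparr>tot = tot P, base = base P, act = snd,
                  gmul = gmul P, ginv = ginv P, gone = gone P\<rparr>"

text \<open>The family \<open>f \<mapsto> P(src f)\<close> indexed by the space of morphisms.\<close>

definition arr_family :: "('o, 'm) icat \<Rightarrow> ('o, 'm, 'p) igrp \<Rightarrow> ('m, 'm, 'm \<times> 'p) igrp" where
  "arr_family A P =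
     \<lparr>tot = fibre_product (Arr A) (tot P) (src A) (base P),
      base = fst,
      act = snd,
      gmul = (\<lambda>((f, x), (g, y)). (f, gmul P (x, y))),
      ginv = (\<lambda>(f, x). (f, ginv P x)),
      gone = (\<lambda>f. (f, gone P (src A f)))\<rparr>"

text \<open>\<open>C\<close> is the coequaliser of the two homomorphisms from the free product of all \<open>P(src f)\<close> to the
  free product of all \<open>P(a)\<close> that send \<open>x\<close> in the copy of \<open>P(src f)\<close> at \<open>f\<close> to \<open>x\<close> and to \<open>P(f)(x)\<close>.\<close>

definition colimit_construction ::
  "'g itself \<Rightarrow> ('o, 'm) icat \<Rightarrow> ('o, 'm, 'p) igrp \<Rightarrow>
     's0 pgrp \<Rightarrow> ('p \<Rightarrow> 's0 \<times> 'o) \<Rightarrow> 's1 pgrp \<Rightarrow> ('m \<times> 'p \<Rightarrow> 's1 \<times> 'm) \<Rightarrow>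
     ('s1 \<Rightarrow> 's0) \<Rightarrow> ('s1 \<Rightarrow> 's0) \<Rightarrow> 'c pgrp \<Rightarrow> ('s0 \<Rightarrow> 'c) \<Rightarrow> bool" where
  "colimit_construction U A P S0 \<iota>0 S1 \<iota>1 u v C q \<longleftrightarrow>
     is_free_product U (Ob A) (ob_family P) S0 \<iota>0 \<and>
     is_free_product U (Arr A) (arr_family A P) S1 \<iota>1 \<and>
     pgrp_hom S1 S0 u \<and> pgrp_hom S1 S0 v \<and>
     (\<forall>(f, x)\<in>topspace (tot (arr_family A P)).
        u (fst (\<iota>1 (f, x))) = fst (\<iota>0 x) \<and>
        v (fst (\<iota>1 (f, x))) = fst (\<iota>0 (act P (f, x)))) \<and>
     is_coequaliser U S1 S0 u v C q"


section \<open>Left adjoints to the constant diagram functor\<close>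

text \<open>\<open>L\<close> on objects and \<open>Lm\<close> on morphisms form a functor, and \<open>\<eta>\<close> is a natural transformation
  from the identity to \<open>Delta A \<circ> L\<close> all of whose components are universal.\<close>

definition left_adjoint_to_Delta ::
  "'g itself \<Rightarrow> ('o, 'm) icat \<Rightarrow> (('o, 'm, 'p) igrp \<Rightarrow> 'c pgrp) \<Rightarrow>
     (('o, 'm, 'p) igrp \<Rightarrow> ('o, 'm, 'p) igrp \<Rightarrow> ('p \<Rightarrow> 'p) \<Rightarrow> 'c \<Rightarrow> 'c) \<Rightarrow>
     (('o, 'm, 'p) igrp \<Rightarrow> 'p \<Rightarrow> 'c \<times> 'o) \<Rightarrow> bool" where
  "left_adjoint_to_Delta U A L Lm \<eta> \<longleftrightarrow>
     (\<forall>P. group_ifun A P \<longrightarrow> is_colimit U A P (L P) (\<eta> P)) \<and>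
     (\<forall>P Q t. group_ifun A P \<and> group_ifun A Q \<and> group_ifun_mor A P Q t \<longrightarrow>
        pgrp_hom (L P) (L Q) (Lm P Q t) \<and>
        (\<forall>x\<in>topspace (tot P). Delta_map (Lm P Q t) (\<eta> P x) = \<eta> Q (t x))) \<and>
     (\<forall>P Q s t. group_ifun A P \<and> group_ifun A Q \<and>
        group_ifun_mor A P Q s \<and> group_ifun_mor A P Q t \<and> (\<forall>x\<in>topspace (tot P). s x = t x) \<longrightarrow>
        (\<forall>y\<in>carrier (L P). Lm P Q s y = Lm P Q t y)) \<and>
     (\<forall>P. group_ifun A P \<longrightarrow> (\<forall>y\<in>carrier (L P). Lm P P id y = y)) \<and>
     (\<forall>P Q R s t. group_ifun A P \<and> group_ifun A Q \<and> group_ifun A R \<and>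
        group_ifun_mor A P Q s \<and> group_ifun_mor A Q R t \<longrightarrow>
        (\<forall>y\<in>carrier (L P). Lm P R (t \<circ> s) y = Lm Q R t (Lm P Q s y)))"

text \<open>For all \<open>A\<close> and all diagrams carried by the given types, the constant diagram functor has a
  left adjoint. The second conjunct makes the adjoint independent of the test type: a single choice of
  \<open>L\<close> is universal for profinite groups of every type \<open>'g\<close>.\<close>

definition PGrp_has_internal_colimits ::
  "'o itself \<Rightarrow> 'm itself \<Rightarrow> 'p itself \<Rightarrow> 'g itself \<Rightarrow> bool" where
  "PGrp_has_internal_colimits TO TM TP TG \<longleftrightarrow>
     (\<forall>A :: ('o, 'm) icat. internal_category A \<longrightarrow>
        (\<exists>(L :: ('o, 'm, 'p) igrp \<Rightarrow> 'p ample pgrp) Lm \<eta>.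
           left_adjoint_to_Delta TYPE('p ample) A L Lm \<eta>) \<and>
        (\<forall>(L :: ('o, 'm, 'p) igrp \<Rightarrow> 'p ample pgrp) Lm \<eta>.
           left_adjoint_to_Delta TYPE('p ample) A L Lm \<eta> \<longrightarrow>
           left_adjoint_to_Delta TG A L Lm \<eta>))"

end

theory Submission
  imports Defs "HOL-Algebra.Generated_Groups"
begin

text \<open>A morphism from \<open>P\<close> to a constant diagram on \<open>G\<close> is the same as a cone: a continuous map from
  the total space of \<open>P\<close> to \<open>G\<close> that is a homomorphism on every fibre and invariant under the action.
  A universal cone is obtained as in the general adjoint functor theorem: take the product of all
  cones into profinite groups of a fixed size and pass to the closed subgroup generated by \<open>P\<close>.
  Words in \<open>P\<close> are dense in it, so it has at most as many elements as there are sets of sets of words,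
  which is the solution set condition. This applies to \<open>A\<close> and to the discrete categories on its
  objects and morphisms; the homomorphisms between the free products, and the fact that the colimit
  is their coequaliser, then follow by comparing universal properties, so that no quotient of a
  profinite group has to be formed.\<close>

section \<open>Closed subgroups and products of profinite groups\<close>

text \<open>The obstacle is size, which in HOL means types. A universal property can only be tested
  against groups over one fixed type, while the product of all cones into such groups has functions
  as elements, a different and larger type. Embedding the generated closed subgroup into
  \<open>'p ample\<close> gives a group whose element type depends on \<open>'p\<close> alone. The
  same embedding, applied to the image of an arbitrary cone, makes every cone testable, so
  universality over one large enough type implies it over every type. The coequaliser depends on
  this freedom: the free product over arrows is obtained with test type
  \<open>('m \<times> 'p) ample\<close>, but has to map into groups over \<open>'p ample\<close>. A
  universal cone that is merely given, rather than built, is not known to generate its group; this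
  is recovered from universality by corestricting the cone to a closed subgroup.\<close>

lemma profinite_space_homeomorphic:
  assumes "X homeomorphic_space Y" "profinite_space X"
  shows "profinite_space Y"
proof -
  obtain f g where fg: "homeomorphic_maps X Y f g"
    using assms(1) by (auto simp: homeomorphic_space_def)
  have "\<exists>a. S \<subseteq> {a}" if S: "connectedin Y S" for S
  proof -
    have g: "continuous_map Y X g" and inv: "\<And>y. y \<in> topspace Y \<Longrightarrow> f (g y) = y"
      using fg by (auto simp: homeomorphic_maps_def)
    obtain a where "g ` S \<subseteq> {a}"
      using assms(2) connectedin_continuous_map_image[OF g S]
      unfolding profinite_space_def by blast
    then have "y = f a" if "y \<in> S" for y
      using inv[of y] that connectedin_subset_topspace[OF S] by (metis image_subset_iff singletonD subsetD)
    then show ?thesis by blast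
  qed
  then show ?thesis
    using assms(2) homeomorphic_compact_space[OF assms(1)] homeomorphic_Hausdorff_space[OF assms(1)]
    by (simp add: profinite_space_def)
qed

lemma profinite_space_closed_subtopology:
  assumes "profinite_space X" "closedin X S"
  shows "profinite_space (subtopology X S)"
  using assms unfolding profinite_space_def
  by (meson Hausdorff_space_subtopology closedin_compact_space compact_space_subtopology
      connectedin_subtopology)

lemma profinite_space_prod:
  assumes "profinite_space X" "profinite_space Y"
  shows "profinite_space (prod_topology X Y)"
proof -
  have "\<exists>a. S \<subseteq> {a}" if S: "connectedin (prod_topology X Y) S" for S
  proof -
    obtain a b where "fst ` S \<subseteq> {a}" "snd ` S \<subseteq> {b}"
      using assms connectedin_continuous_map_image[OF continuous_map_fst S]
        connectedin_continuous_map_image[OF continuous_map_snd S]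
      unfolding profinite_space_def by meson
    then have "S \<subseteq> {(a, b)}" by force
    then show ?thesis by blast
  qed
  then show ?thesis
    using assms unfolding profinite_space_def
    by (simp add: compact_space_prod_topology Hausdorff_space_prod_topology)
qed

lemma profinite_space_product:
  assumes "\<And>i. i \<in> I \<Longrightarrow> profinite_space (X i)"
  shows "profinite_space (product_topology X I)"
proof -
  have "\<exists>a. S \<subseteq> {a}" if S: "connectedin (product_topology X I) S" for S
  proof -
    have sub: "S \<subseteq> (\<Pi>\<^sub>E i\<in>I. topspace (X i))"
      using connectedin_subset_topspace[OF S] by simp
    have "x = y" if "x \<in> S" "y \<in> S" for x y
    proof (rule PiE_ext)
      fix i assume i: "i \<in> I"
      obtain a where "(\<lambda>x. x i) ` S \<subseteq> {a}"
        using assms[OF i] connectedin_continuous_map_image[OF continuous_map_product_projection[OF i] S]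
        unfolding profinite_space_def by meson
      then show "x i = y i" using that by (metis image_subset_iff singletonD)
    next
      show "x \<in> (\<Pi>\<^sub>E i\<in>I. topspace (X i))" "y \<in> (\<Pi>\<^sub>E i\<in>I. topspace (X i))"
        using sub that by blast+
    qed
    then show ?thesis by (metis subsetI singletonI)
  qed
  then show ?thesis
    using assms unfolding profinite_space_def
    by (auto simp: compact_space_product_topology Hausdorff_space_product_topology)
qed

lemma profinite_group_mult_continuous:
  assumes "profinite_group G" "continuous_map T (gtop G) f" "continuous_map T (gtop G) g"
  shows "continuous_map T (gtop G) (\<lambda>t. f t \<otimes>\<^bsub>G\<^esub> g t)"
proof -
  have "continuous_map T (prod_topology (gtop G) (gtop G)) (\<lambda>t. (f t, g t))"
    using assms by (simp add: continuous_map_paired)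
  from continuous_map_compose[OF this] assms(1) show ?thesis
    by (fastforce simp: profinite_group_def o_def)
qed

lemma profinite_group_inv_continuous:
  assumes "profinite_group G" "continuous_map T (gtop G) f"
  shows "continuous_map T (gtop G) (\<lambda>t. inv\<^bsub>G\<^esub> f t)"
  using continuous_map_compose[OF assms(2)] assms(1) by (fastforce simp: profinite_group_def o_def)

section \<open>Products of profinite groups\<close>

definition prod_pgrp :: "'i set \<Rightarrow> ('i \<Rightarrow> 'a pgrp) \<Rightarrow> ('i \<Rightarrow> 'a) pgrp" where
  "prod_pgrp I G = \<lparr>carrier = (\<Pi>\<^sub>E i\<in>I. carrier (G i)), mult = (\<lambda>x y. \<lambda>i\<in>I. x i \<otimes>\<^bsub>G i\<^esub> y i),
     one = (\<lambda>i\<in>I. \<one>\<^bsub>G i\<^esub>), gtop = product_topology (\<lambda>i. gtop (G i)) I\<rparr>"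

lemma prod_pgrp_simps [simp]:
  "carrier (prod_pgrp I G) = (\<Pi>\<^sub>E i\<in>I. carrier (G i))"
  "x \<otimes>\<^bsub>prod_pgrp I G\<^esub> y = (\<lambda>i\<in>I. x i \<otimes>\<^bsub>G i\<^esub> y i)"
  "\<one>\<^bsub>prod_pgrp I G\<^esub> = (\<lambda>i\<in>I. \<one>\<^bsub>G i\<^esub>)"
  "gtop (prod_pgrp I G) = product_topology (\<lambda>i. gtop (G i)) I"
  by (simp_all add: prod_pgrp_def)

lemma profinite_group_prod:
  assumes G: "\<And>i. i \<in> I \<Longrightarrow> profinite_group (G i)"
  shows "profinite_group (prod_pgrp I G)"
proof -
  let ?P = "prod_pgrp I G"
  have grp: "group (G i)" and top: "topspace (gtop (G i)) = carrier (G i)" if "i \<in> I" for i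
    using G[OF that] by (auto simp: profinite_group_def)
  have inv_in: "(\<lambda>i\<in>I. inv\<^bsub>G i\<^esub> x i) \<in> carrier ?P" if "x \<in> carrier ?P" for x
    using that grp by (auto intro!: group.inv_closed)
  have linv: "(\<lambda>i\<in>I. inv\<^bsub>G i\<^esub> x i) \<otimes>\<^bsub>?P\<^esub> x = \<one>\<^bsub>?P\<^esub>" if "x \<in> carrier ?P" for x
    using that by (auto intro!: restrict_ext group.l_inv grp)
  have P: "group ?P"
  proof (rule groupI)
    fix x y z assume "x \<in> carrier ?P" "y \<in> carrier ?P" "z \<in> carrier ?P"
    then show "x \<otimes>\<^bsub>?P\<^esub> y \<otimes>\<^bsub>?P\<^esub> z = x \<otimes>\<^bsub>?P\<^esub> (y \<otimes>\<^bsub>?P\<^esub> z)"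
      using grp by (auto intro!: restrict_ext monoid.m_assoc group.is_monoid)
  next
    fix x y assume "x \<in> carrier ?P" "y \<in> carrier ?P"
    then show "x \<otimes>\<^bsub>?P\<^esub> y \<in> carrier ?P"
      using grp by (auto intro!: monoid.m_closed group.is_monoid)
  next
    show "\<one>\<^bsub>?P\<^esub> \<in> carrier ?P"
      using grp by (auto intro!: monoid.one_closed group.is_monoid)
  next
    fix x assume x: "x \<in> carrier ?P"
    then have "\<one>\<^bsub>?P\<^esub> \<otimes>\<^bsub>?P\<^esub> x = restrict x I"
      unfolding prod_pgrp_simps
      by (intro restrict_ext) (auto intro!: monoid.l_one group.is_monoid grp)
    then show "\<one>\<^bsub>?P\<^esub> \<otimes>\<^bsub>?P\<^esub> x = x"
      using x by (simp add: PiE_restrict)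
    show "\<exists>y\<in>carrier ?P. y \<otimes>\<^bsub>?P\<^esub> x = \<one>\<^bsub>?P\<^esub>"
      using inv_in[OF x] linv[OF x] by blast
  qed
  have proj: "continuous_map (prod_topology (gtop ?P) (gtop ?P)) (gtop (G i)) (\<lambda>p. fst p i)"
    "continuous_map (prod_topology (gtop ?P) (gtop ?P)) (gtop (G i)) (\<lambda>p. snd p i)"
    "continuous_map (gtop ?P) (gtop (G i)) (\<lambda>x. x i)"
    if "i \<in> I" for i
    using continuous_map_compose[OF continuous_map_fst continuous_map_product_projection[OF that]]
      continuous_map_compose[OF continuous_map_snd continuous_map_product_projection[OF that]]
      continuous_map_product_projection[OF that]
    by (simp_all add: o_def)
  have mult: "continuous_map (prod_topology (gtop ?P) (gtop ?P)) (gtop ?P) (\<lambda>(x, y). x \<otimes>\<^bsub>?P\<^esub> y)"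
    using profinite_group_mult_continuous[OF G proj(1,2)]
    by (auto simp: continuous_map_componentwise case_prod_unfold)
  have "continuous_map (gtop ?P) (gtop ?P) (\<lambda>x. \<lambda>i\<in>I. inv\<^bsub>G i\<^esub> x i)"
    using profinite_group_inv_continuous[OF G proj(3)]
    by (auto simp: continuous_map_componentwise)
  moreover have top_P: "topspace (gtop ?P) = carrier ?P"
    using top by (simp cong: PiE_cong)
  \<comment> \<open>The inverse is not a field of the record; identifying it on the carrier with the
    coordinatewise one transfers the continuity shown above.\<close>
  moreover have "inv\<^bsub>?P\<^esub> x = (\<lambda>i\<in>I. inv\<^bsub>G i\<^esub> x i)" if "x \<in> carrier ?P" for x
    using group.inv_equality[OF P linv[OF that] that inv_in[OF that]] .
  ultimately have "continuous_map (gtop ?P) (gtop ?P) (\<lambda>x. inv\<^bsub>?P\<^esub> x)"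
    by (metis (mono_tags, lifting) continuous_map_eq)
  then show ?thesis
    using P mult top_P G profinite_space_product[of I "\<lambda>i. gtop (G i)"]
    by (simp add: profinite_group_def)
qed

section \<open>Closures, equalisers and topological generation\<close>

abbreviation grp_closure :: "'a pgrp \<Rightarrow> 'a set \<Rightarrow> 'a set" where
  "grp_closure G K \<equiv> gtop G closure_of K"

text \<open>A continuous map sends the closure of a set into the closure of its image. This is
  applied to inversion on \<open>K\<close> and to multiplication on \<open>K \<times> K\<close>,
  whose closure is the product of the closures.\<close>

lemma subgroup_closure:
  fixes G :: "'a pgrp" (structure)
  assumes G: "profinite_group G" and K: "subgroup K G"
  shows "subgroup (grp_closure G K) G"
proof -
  interpret group G using G by (simp add: profinite_group_def)
  interpret K: subgroup K G by (rule K)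
  have top: "topspace (gtop G) = carrier G"
    and m: "continuous_map (prod_topology (gtop G) (gtop G)) (gtop G) (\<lambda>(x, y). x \<otimes> y)"
    and i: "continuous_map (gtop G) (gtop G) (\<lambda>x. inv x)"
    using G by (auto simp: profinite_group_def)
  have KK: "(\<lambda>(x, y). x \<otimes> y) ` (K \<times> K) \<subseteq> K" "(\<lambda>x. inv x) ` K \<subseteq> K" by auto
  have "(\<lambda>(x, y). x \<otimes> y) ` (grp_closure G K \<times> grp_closure G K) \<subseteq> grp_closure G K"
    using continuous_map_image_closure_subset[OF m, of "K \<times> K"] closure_of_mono[OF KK(1), of "gtop G"]
    unfolding closure_of_Times by blast
  moreover have "(\<lambda>x. inv x) ` (grp_closure G K) \<subseteq> grp_closure G K"
    using continuous_map_image_closure_subset[OF i, of K] closure_of_mono[OF KK(2), of "gtop G"]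
    by blast
  moreover have "K \<subseteq> grp_closure G K" "grp_closure G K \<subseteq> carrier G"
    using closure_of_subset[of K "gtop G"] K.subset closure_of_subset_topspace[of "gtop G" K]
    by (auto simp: top)
  ultimately show ?thesis
    using K.one_closed by unfold_locales (auto simp: image_subset_iff)
qed

text \<open>Closedness comes from the target being Hausdorff. Together with topological generation
  this turns agreement on generators into agreement everywhere.\<close>

lemma subgroup_equaliser:
  assumes G: "profinite_group G" and H: "profinite_group H"
    and h: "pgrp_hom G H h" "pgrp_hom G H h'"
  shows "subgroup {x \<in> carrier G. h x = h' x} G" "closedin (gtop G) {x \<in> carrier G. h x = h' x}"
proof -
  interpret group G using G by (simp add: profinite_group_def)
  interpret H: group H using H by (simp add: profinite_group_def)
  interpret h: group_hom G H h
    using h(1) by unfold_locales (simp add: pgrp_hom_def)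
  interpret h': group_hom G H h'
    using h(2) by unfold_locales (simp add: pgrp_hom_def)
  show "subgroup {x \<in> carrier G. h x = h' x} G"
    by unfold_locales auto
  show "closedin (gtop G) {x \<in> carrier G. h x = h' x}"
    using closedin_continuous_maps_eq[of "gtop H" "gtop G" h h'] G H h
    by (simp add: profinite_group_def profinite_space_def pgrp_hom_def)
qed

text \<open>Quantifying over closed subgroups instead of forming a closure suits both uses: an
  equaliser is such an \<open>M\<close>, and universality of a cone shows directly that every such
  \<open>M\<close> is the whole group.\<close>

definition topologically_generates :: "'a pgrp \<Rightarrow> 'a set \<Rightarrow> bool" where
  "topologically_generates G S \<longleftrightarrow> S \<subseteq> carrier G \<and>
     (\<forall>M. subgroup M G \<and> closedin (gtop G) M \<and> S \<subseteq> M \<longrightarrow> M = carrier G)"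

lemma pgrp_hom_eq_on_generators:
  assumes "profinite_group G" "profinite_group H" "pgrp_hom G H h" "pgrp_hom G H h'"
    and "topologically_generates G S" "\<And>x. x \<in> S \<Longrightarrow> h x = h' x" "y \<in> carrier G"
  shows "h y = h' y"
proof -
  let ?E = "{x \<in> carrier G. h x = h' x}"
  have "S \<subseteq> ?E"
    using assms(5,6) by (auto simp: topologically_generates_def)
  with subgroup_equaliser[OF assms(1-4)] assms(5) have "?E = carrier G"
    unfolding topologically_generates_def by meson
  then show ?thesis using assms(7) by blast
qed

lemma pgrp_hom_comp:
  assumes "pgrp_hom G H h" "pgrp_hom H K k"
  shows "pgrp_hom G K (k \<circ> h)"
  using assms hom_compose continuous_map_compose by (auto simp: pgrp_hom_def)

lemma pgrp_hom_eq:
  assumes "profinite_group G" "pgrp_hom G H h" "\<And>x. x \<in> carrier G \<Longrightarrow> h x = h' x"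
  shows "pgrp_hom G H h'"
proof -
  interpret group G using assms(1) by (simp add: profinite_group_def)
  have "h' \<in> hom G H"
    using assms(2,3) unfolding pgrp_hom_def hom_def by (simp add: Pi_iff)
  then show ?thesis
    using assms continuous_map_eq[of "gtop G" "gtop H" h h']
    by (simp add: pgrp_hom_def profinite_group_def)
qed

section \<open>Copies of closed subgroups over another type\<close>

text \<open>Transport of structure along an injection, used to move a group into the type against
  which a universal property is tested. Pulling the topology back along the inverse makes
  \<open>e\<close> a homeomorphism from the subspace \<open>H\<close>.\<close>

definition sub_copy :: "'a pgrp \<Rightarrow> 'a set \<Rightarrow> ('a \<Rightarrow> 'b) \<Rightarrow> 'b pgrp" where
  "sub_copy G H e = \<lparr>carrier = e ` H, mult = (\<lambda>a b. e (inv_into H e a \<otimes>\<^bsub>G\<^esub> inv_into H e b)),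
     one = e \<one>\<^bsub>G\<^esub>, gtop = pullback_topology (e ` H) (inv_into H e) (gtop G)\<rparr>"

context
  fixes G :: "'a pgrp" (structure) and H :: "'a set" and e :: "'a \<Rightarrow> 'b"
  assumes G: "profinite_group G" and H: "subgroup H G" and clo: "closedin (gtop G) H"
    and inj: "inj_on e H"
begin

interpretation group G using G by (simp add: profinite_group_def)
interpretation H: subgroup H G by (rule H)

lemma sub_copy_simps:
  "carrier (sub_copy G H e) = e ` H"
  "x \<in> H \<Longrightarrow> y \<in> H \<Longrightarrow> e x \<otimes>\<^bsub>sub_copy G H e\<^esub> e y = e (x \<otimes>\<^bsub>G\<^esub> y)"
  "\<one>\<^bsub>sub_copy G H e\<^esub> = e \<one>\<^bsub>G\<^esub>"
  "gtop (sub_copy G H e) = pullback_topology (e ` H) (inv_into H e) (gtop G)"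
  using inj by (simp_all add: sub_copy_def)

lemma topspace_sub_copy: "topspace (gtop (sub_copy G H e)) = e ` H"
  using G inj H.subset
  by (auto simp: sub_copy_simps topspace_pullback_topology profinite_group_def)

lemma continuous_map_sub_copy_inv: "continuous_map (gtop (sub_copy G H e)) (gtop G) (inv_into H e)"
  using continuous_map_pullback[OF continuous_map_id, of "e ` H" "inv_into H e" "gtop G"]
  by (simp add: sub_copy_simps o_def)

lemma continuous_map_into_sub_copy:
  assumes "continuous_map T (gtop G) f" "\<And>t. t \<in> topspace T \<Longrightarrow> f t \<in> H"
  shows "continuous_map T (gtop (sub_copy G H e)) (e \<circ> f)"
  unfolding sub_copy_simps
proof (rule continuous_map_pullback')
  show "continuous_map T (gtop G) (inv_into H e \<circ> (e \<circ> f))"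
    using assms inj by (auto intro: continuous_map_eq[OF assms(1)])
qed (use assms in auto)

lemma group_sub_copy: "group (sub_copy G H e)"
proof (rule groupI)
  fix x assume "x \<in> carrier (sub_copy G H e)"
  then obtain a where a: "a \<in> H" "x = e a" by (auto simp: sub_copy_simps)
  then have "e (inv a) \<otimes>\<^bsub>sub_copy G H e\<^esub> x = \<one>\<^bsub>sub_copy G H e\<^esub>"
    by (simp add: sub_copy_simps)
  then show "\<exists>y\<in>carrier (sub_copy G H e). y \<otimes>\<^bsub>sub_copy G H e\<^esub> x = \<one>\<^bsub>sub_copy G H e\<^esub>"
    by (rule bexI) (use a in \<open>simp add: sub_copy_simps\<close>)
qed (auto simp: sub_copy_simps m_assoc)

lemma inv_sub_copy: "x \<in> H \<Longrightarrow> inv\<^bsub>sub_copy G H e\<^esub> (e x) = e (inv x)"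
  by (rule group.inv_equality[OF group_sub_copy]) (simp_all add: sub_copy_simps)

lemma profinite_group_sub_copy: "profinite_group (sub_copy G H e)"
proof -
  let ?K = "sub_copy G H e"
  have "homeomorphic_maps (subtopology (gtop G) H) (gtop ?K) e (inv_into H e)"
    unfolding homeomorphic_maps_def
    using continuous_map_sub_copy_inv inj
      continuous_map_into_sub_copy[OF continuous_map_from_subtopology[OF continuous_map_id], of H]
    by (auto simp: topspace_sub_copy continuous_map_in_subtopology inv_into_into)
  then have "profinite_space (gtop ?K)"
    using profinite_space_homeomorphic profinite_space_closed_subtopology[OF _ clo] G
    by (auto simp: homeomorphic_space_def profinite_group_def)
  moreover have "continuous_map (prod_topology (gtop ?K) (gtop ?K)) (gtop ?K) (\<lambda>(x, y). x \<otimes>\<^bsub>?K\<^esub> y)"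
  proof (rule continuous_map_eq)
    show "continuous_map (prod_topology (gtop ?K) (gtop ?K)) (gtop ?K)
        (e \<circ> (\<lambda>p. inv_into H e (fst p) \<otimes> inv_into H e (snd p)))"
    proof (rule continuous_map_into_sub_copy, rule profinite_group_mult_continuous[OF G])
      show "continuous_map (prod_topology (gtop ?K) (gtop ?K)) (gtop G) (\<lambda>p. inv_into H e (fst p))"
        "continuous_map (prod_topology (gtop ?K) (gtop ?K)) (gtop G) (\<lambda>p. inv_into H e (snd p))"
        using continuous_map_compose[OF continuous_map_fst continuous_map_sub_copy_inv]
          continuous_map_compose[OF continuous_map_snd continuous_map_sub_copy_inv]
        by (simp_all add: o_def)
    qed (auto simp: topspace_sub_copy inv_into_into)
  qed (auto simp: sub_copy_def)
  moreover have "continuous_map (gtop ?K) (gtop ?K) (\<lambda>x. inv\<^bsub>?K\<^esub> x)"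
  proof (rule continuous_map_eq)
    show "continuous_map (gtop ?K) (gtop ?K) (e \<circ> (\<lambda>x. inv (inv_into H e x)))"
      by (rule continuous_map_into_sub_copy,
          rule profinite_group_inv_continuous[OF G continuous_map_sub_copy_inv])
        (auto simp: topspace_sub_copy inv_into_into)
  qed (use inj in \<open>auto simp: topspace_sub_copy inv_sub_copy\<close>)
  ultimately show ?thesis
    using group_sub_copy topspace_sub_copy by (simp add: profinite_group_def sub_copy_simps(1))
qed

lemma pgrp_hom_sub_copy_inv: "pgrp_hom (sub_copy G H e) G (inv_into H e)"
  using continuous_map_sub_copy_inv inj
  by (auto simp: pgrp_hom_def hom_def sub_copy_simps)

text \<open>A closed subgroup of the copy pulls back along \<open>e\<close> to a subgroup that is
  closed in \<open>H\<close>, hence in \<open>G\<close>. If it contains \<open>S\<close>, it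
  contains the closure of the subgroup generated by \<open>S\<close>, which is
  \<open>H\<close>.\<close>

lemma topologically_generates_sub_copy:
  assumes S: "S \<subseteq> H" and gen: "H = grp_closure G (generate G S)"
  shows "topologically_generates (sub_copy G H e) (e ` S)"
  unfolding topologically_generates_def
proof (intro conjI allI impI)
  let ?K = "sub_copy G H e"
  show "e ` S \<subseteq> carrier ?K" using S by (auto simp: sub_copy_simps)
  fix M assume M: "subgroup M ?K \<and> closedin (gtop ?K) M \<and> e ` S \<subseteq> M"
  let ?N = "{x \<in> H. e x \<in> M}"
  interpret M: subgroup M ?K using M by simp
  have sub: "subgroup ?N G"
  proof
    fix x y assume "x \<in> ?N" "y \<in> ?N"
    then show "x \<otimes> y \<in> ?N" using M.m_closed[of "e x" "e y"] by (auto simp: sub_copy_simps)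
  next
    fix x assume "x \<in> ?N"
    then show "inv x \<in> ?N" using M.m_inv_closed[of "e x"] by (auto simp: inv_sub_copy)
  qed (use M.one_closed in \<open>auto simp: sub_copy_simps\<close>)
  have "closedin (subtopology (gtop G) H) {x \<in> topspace (subtopology (gtop G) H). e x \<in> M}"
    by (rule closedin_continuous_map_preimage[of _ "gtop ?K"])
      (use M continuous_map_into_sub_copy[OF continuous_map_from_subtopology[OF continuous_map_id], of H]
        in \<open>auto simp: o_def\<close>)
  moreover have "{x \<in> topspace (subtopology (gtop G) H). e x \<in> M} = ?N"
    using G H.subset by (auto simp: profinite_group_def)
  ultimately have "closedin (gtop G) ?N"
    using clo closedin_trans_full by metis
  moreover have "S \<subseteq> ?N" using S M by auto
  ultimately have "grp_closure G (generate G S) \<subseteq> ?N"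
    by (intro closure_of_minimal generate_subgroup_incl sub)
  then have "H \<subseteq> ?N"
    using gen by (metis (lifting))
  then show "M = carrier ?K"
    using M.subset by (auto simp: sub_copy_simps)
qed

end

lemma closed_generated:
  assumes G: "profinite_group G" and S: "S \<subseteq> carrier G"
  shows "subgroup (grp_closure G (generate G S)) G"
    "closedin (gtop G) (grp_closure G (generate G S))"
    "S \<subseteq> grp_closure G (generate G S)"
proof -
  interpret group G using G by (simp add: profinite_group_def)
  show "subgroup (grp_closure G (generate G S)) G"
    by (rule subgroup_closure[OF G generate_is_subgroup[OF S]])
  show "S \<subseteq> grp_closure G (generate G S)"
    using closure_of_subset[of "generate G S" "gtop G"] generate_incl[OF S] generate.incl[of _ S G] G
    by (auto simp: profinite_group_def)
qed simp

text \<open>A point of a Hausdorff space is determined by the traces of its neighbourhoods on a dense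
  subset; here the dense subset is parametrised by words.\<close>

lemma closure_generate_ample:
  fixes G :: "'g pgrp" (structure) and c :: "'p \<Rightarrow> 'g"
  assumes G: "profinite_group G" and X: "c ` X \<subseteq> carrier G"
    and inv: "\<And>x. x \<in> X \<Longrightarrow> inv\<^bsub>G\<^esub> c x \<in> c ` X"
  shows "\<exists>e :: 'g \<Rightarrow> 'p ample. inj_on e (grp_closure G (generate G (c ` X)))"
proof -
  interpret group G using G by (simp add: profinite_group_def)
  \<comment> \<open>Words need no formal inverses: by assumption the inverse of a generator is a
    generator again, so it is the value of a one-letter word.\<close>
  define val where "val w = foldr (\<lambda>x y. c x \<otimes> y) w \<one>" for w
  have val_closed: "val w \<in> carrier G" if "w \<in> lists X" for w
    using that X by (induction w) (auto simp: val_def)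
  have val_append: "val (v @ w) = val v \<otimes> val w" if "v \<in> lists X" "w \<in> lists X" for v w
    using that(1)
  proof (induction v)
    case Nil
    then show ?case using val_closed[OF that(2)] by (simp add: val_def)
  next
    case (Cons x v)
    then have "c x \<in> carrier G" using X by auto
    then show ?case
      using Cons val_closed[OF that(2)] val_closed[of v] by (simp add: val_def m_assoc)
  qed
  have words: "g \<in> val ` lists X" if "g \<in> generate G (c ` X)" for g
    using that
  proof (induction)
    case one
    have "\<one> = val []" by (simp add: val_def)
    then show ?case by blast
  next
    case (incl h)
    then obtain x where "x \<in> X" "h = c x" by auto
    then have "h = val [x]" "[x] \<in> lists X" using X by (auto simp: val_def)
    then show ?case by blast
  next
    case (inv h)
    then obtain x where "x \<in> X" "inv h = c x" using assms(3) by auto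
    then have "inv h = val [x]" "[x] \<in> lists X" using X by (auto simp: val_def)
    then show ?case by blast
  next
    case (eng g h)
    then obtain v w where "v \<in> lists X" "w \<in> lists X" "g = val v" "h = val w" by auto
    then have "g \<otimes> h = val (v @ w)" "v @ w \<in> lists X" by (auto simp: val_append)
    then show ?case by blast
  qed
  define e where "e g = {{w. val w \<in> U} | U. openin (gtop G) U \<and> g \<in> U}" for g
  have "g = g'" if g: "g \<in> topspace (gtop G)" and g': "g' \<in> grp_closure G (generate G (c ` X))"
    and eq: "e g = e g'" for g g'
  proof (rule ccontr)
    assume "g \<noteq> g'"
    moreover have "g' \<in> topspace (gtop G)"
      using g' closure_of_subset_topspace by fast
    ultimately obtain U V where UV: "openin (gtop G) U" "openin (gtop G) V" "g \<in> U" "g' \<in> V" "disjnt U V"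
      using G g unfolding profinite_group_def profinite_space_def Hausdorff_space_def by metis
    \<comment> \<open>The trace of \<open>U\<close> is also the trace of a neighbourhood
      \<open>W\<close> of \<open>g'\<close>. A word with value in \<open>V \<inter> W\<close> then
      has its value in \<open>U\<close> too, although \<open>U\<close> and \<open>V\<close> are
      disjoint.\<close>
    then have "{w. val w \<in> U} \<in> e g'"
      using eq by (auto simp: e_def)
    then obtain W where W: "openin (gtop G) W" "g' \<in> W" "{w. val w \<in> U} = {w. val w \<in> W}"
      by (auto simp: e_def)
    then obtain k where "k \<in> generate G (c ` X)" "k \<in> V \<inter> W"
      using g' UV unfolding in_closure_of by (meson IntI openin_Int)
    then obtain w where "val w \<in> V" "val w \<in> W"
      using words by blast
    then have "val w \<in> U" using W(3) by blast
    then show False using \<open>val w \<in> V\<close> UV(5) by (auto simp: disjnt_def)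
  qed
  then have "inj_on e (grp_closure G (generate G (c ` X)))"
    using closure_of_subset_topspace[of "gtop G"] by (meson inj_onI subsetD)
  then show ?thesis by blast
qed

section \<open>Universal cones\<close>

definition cone :: "('o, 'm) icat \<Rightarrow> ('o, 'm, 'p) igrp \<Rightarrow> 'g pgrp \<Rightarrow> ('p \<Rightarrow> 'g) \<Rightarrow> bool" where
  "cone A P G c \<longleftrightarrow> continuous_map (tot P) (gtop G) c \<and>
     (\<forall>x\<in>topspace (tot P). \<forall>y\<in>topspace (tot P). base P x = base P y \<longrightarrow>
        c (gmul P (x, y)) = c x \<otimes>\<^bsub>G\<^esub> c y) \<and>
     (\<forall>f\<in>topspace (Arr A). \<forall>x\<in>topspace (tot P). src A f = base P x \<longrightarrow> c (act P (f, x)) = c x)"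

lemma fibre_simps [simp]:
  "carrier (fibre P a) = {x \<in> topspace (tot P). base P x = a}"
  "x \<otimes>\<^bsub>fibre P a\<^esub> y = gmul P (x, y)"
  "\<one>\<^bsub>fibre P a\<^esub> = gone P a"
  by (simp_all add: fibre_def)

lemma Delta_simps [simp]:
  "tot (Delta A G) = prod_topology (gtop G) (Ob A)"
  "base (Delta A G) = snd"
  "act (Delta A G) (f, z) = (fst z, tgt A f)"
  "gmul (Delta A G) (z, w) = (fst z \<otimes>\<^bsub>G\<^esub> fst w, snd z)"
  by (simp_all add: Delta_def case_prod_unfold)

lemma Delta_map_simp [simp]: "Delta_map h z = (h (fst z), snd z)"
  by (simp add: Delta_map_def map_prod_def case_prod_unfold)

lemma group_ifun_base:
  assumes "group_ifun A P"
  shows "continuous_map (tot P) (Ob A) (base P)"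
    "x \<in> topspace (tot P) \<Longrightarrow> base P x \<in> topspace (Ob A)"
    "f \<in> topspace (Arr A) \<Longrightarrow> x \<in> topspace (tot P) \<Longrightarrow> src A f = base P x \<Longrightarrow>
      base P (act P (f, x)) = tgt A f"
proof -
  show b: "continuous_map (tot P) (Ob A) (base P)"
    using assms by (auto simp: group_ifun_def internal_functor_def)
  show "x \<in> topspace (tot P) \<Longrightarrow> base P x \<in> topspace (Ob A)"
    using continuous_map_image_subset_topspace[OF b] by blast
  show "f \<in> topspace (Arr A) \<Longrightarrow> x \<in> topspace (tot P) \<Longrightarrow> src A f = base P x \<Longrightarrow>
      base P (act P (f, x)) = tgt A f"
    using assms by (auto simp: group_ifun_def internal_functor_def)
qed

text \<open>Compatibility with the base forces the second component, so the first carries all the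
  information. The converse also needs products and translates to lie in the expected fibres,
  because that is where the second component is read off.\<close>

lemma group_ifun_mor_Delta_iff:
  assumes P: "group_ifun A P" and G: "profinite_group G"
  shows "group_ifun_mor A P (Delta A G) t \<longleftrightarrow>
    cone A P G (fst \<circ> t) \<and> (\<forall>x\<in>topspace (tot P). snd (t x) = base P x)"
    (is "?L \<longleftrightarrow> ?R")
proof
  assume L: ?L
  then have t: "continuous_map (tot P) (prod_topology (gtop G) (Ob A)) t"
    and b: "\<And>x. x \<in> topspace (tot P) \<Longrightarrow> snd (t x) = base P x"
    and a: "\<And>f x. f \<in> topspace (Arr A) \<Longrightarrow> x \<in> topspace (tot P) \<Longrightarrow> src A f = base P x \<Longrightarrow>
      t (act P (f, x)) = (fst (t x), tgt A f)"
    and h: "\<And>a. a \<in> topspace (Ob A) \<Longrightarrow> t \<in> hom (fibre P a) (fibre (Delta A G) a)"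
    unfolding group_ifun_mor_def internal_nat_trans_def by simp_all
  have "fst (t (gmul P (x, y))) = fst (t x) \<otimes>\<^bsub>G\<^esub> fst (t y)"
    if "x \<in> topspace (tot P)" "y \<in> topspace (tot P)" "base P x = base P y" for x y
    using hom_mult[OF h[OF group_ifun_base(2)[OF P that(1)]], of x y] that by simp
  then show ?R
    using t a b by (simp add: cone_def continuous_map_pairwise)
next
  assume R: ?R
  have c: "continuous_map (tot P) (gtop G) (fst \<circ> t)"
    and b: "\<And>x. x \<in> topspace (tot P) \<Longrightarrow> snd (t x) = base P x"
    using R by (auto simp: cone_def)
  have t: "continuous_map (tot P) (prod_topology (gtop G) (Ob A)) t"
    using c b continuous_map_eq[OF group_ifun_base(1)[OF P], of "snd \<circ> t"]
    by (simp add: continuous_map_pairwise)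
  have clo: "gmul P (x, y) \<in> topspace (tot P)" "base P (gmul P (x, y)) = base P x"
    if "x \<in> topspace (tot P)" "y \<in> topspace (tot P)" "base P x = base P y" for x y
  proof -
    interpret group "fibre P (base P x)"
      using P group_ifun_base(2)[OF P that(1)] by (simp add: group_ifun_def)
    show "gmul P (x, y) \<in> topspace (tot P)" "base P (gmul P (x, y)) = base P x"
      using m_closed[of x y] that by simp_all
  qed
  have act: "act P (f, x) \<in> topspace (tot P)"
    if "f \<in> topspace (Arr A)" "x \<in> topspace (tot P)" "src A f = base P x" for f x
  proof -
    have "continuous_map (fibre_product (Arr A) (tot P) (src A) (base P)) (tot P) (act P)"
      using P by (simp add: group_ifun_def internal_functor_def)
    then show ?thesis
      using that by (auto simp: continuous_map_def fibre_product_def)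
  qed
  have "t \<in> hom (fibre P a) (fibre (Delta A G) a)" if "a \<in> topspace (Ob A)" for a
  proof (rule homI)
    fix x assume x: "x \<in> carrier (fibre P a)"
    then show "t x \<in> carrier (fibre (Delta A G) a)"
      using continuous_map_image_subset_topspace[OF t] b by auto
    fix y assume "y \<in> carrier (fibre P a)"
    then show "t (x \<otimes>\<^bsub>fibre P a\<^esub> y) = t x \<otimes>\<^bsub>fibre (Delta A G) a\<^esub> t y"
      using x R clo[of x y] by (auto simp: cone_def prod_eq_iff)
  qed
  then show ?L
    using R t b act group_ifun_base(3)[OF P]
    by (auto simp: group_ifun_mor_def internal_nat_trans_def cone_def prod_eq_iff)
qed

section \<open>The universal property of colimits in terms of cones\<close>

definition universal_cone ::
  "'g itself \<Rightarrow> ('o, 'm) icat \<Rightarrow> ('o, 'm, 'p) igrp \<Rightarrow> 'c pgrp \<Rightarrow> ('p \<Rightarrow> 'c) \<Rightarrow> bool" where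
  "universal_cone U A P C d \<longleftrightarrow> profinite_group C \<and> cone A P C d \<and>
     (\<forall>(G :: 'g pgrp) c. profinite_group G \<and> cone A P G c \<longrightarrow>
        (\<exists>h. pgrp_hom C G h \<and> (\<forall>x\<in>topspace (tot P). h (d x) = c x) \<and>
          (\<forall>h'. pgrp_hom C G h' \<and> (\<forall>x\<in>topspace (tot P). h' (d x) = c x) \<longrightarrow>
             (\<forall>y\<in>carrier C. h' y = h y))))"

lemma universal_coneE:
  fixes G :: "'g pgrp"
  assumes "universal_cone TYPE('g) A P C d" "profinite_group G" "cone A P G c"
  obtains h where "pgrp_hom C G h" "\<And>x. x \<in> topspace (tot P) \<Longrightarrow> h (d x) = c x"
  using assms unfolding universal_cone_def by meson

lemma is_colimit_iff:
  fixes U :: "'g itself"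
  assumes P: "group_ifun A P"
  shows "is_colimit U A P C \<eta> \<longleftrightarrow>
    universal_cone U A P C (fst \<circ> \<eta>) \<and> (\<forall>x\<in>topspace (tot P). snd (\<eta> x) = base P x)"
    (is "?L \<longleftrightarrow> ?R")
\<comment> \<open>Both sides imply this conjunction. Once it is assumed, only the two quantified
  universal properties remain to be compared.\<close>
proof (cases "profinite_group C \<and> cone A P C (fst \<circ> \<eta>) \<and> (\<forall>x\<in>topspace (tot P). snd (\<eta> x) = base P x)")
  case False
  then show ?thesis
    using group_ifun_mor_Delta_iff[OF P] by (auto simp: is_colimit_def universal_cone_def)
next
  case C: True
  define uni where "uni G c \<longleftrightarrow> (\<exists>h. pgrp_hom C G h \<and> (\<forall>x\<in>topspace (tot P). h (fst (\<eta> x)) = c x) \<and>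
          (\<forall>h'. pgrp_hom C G h' \<and> (\<forall>x\<in>topspace (tot P). h' (fst (\<eta> x)) = c x) \<longrightarrow>
             (\<forall>y\<in>carrier C. h' y = h y)))" for G :: "'g pgrp" and c
  have mor: "profinite_group C" "group_ifun_mor A P (Delta A C) \<eta>"
    using C group_ifun_mor_Delta_iff[OF P, of C] by auto
  have "?L \<longleftrightarrow> (\<forall>(G :: 'g pgrp) \<phi>. profinite_group G \<and> group_ifun_mor A P (Delta A G) \<phi> \<longrightarrow>
      (\<exists>h. pgrp_hom C G h \<and> (\<forall>x\<in>topspace (tot P). Delta_map h (\<eta> x) = \<phi> x) \<and>
          (\<forall>h'. pgrp_hom C G h' \<and> (\<forall>x\<in>topspace (tot P). Delta_map h' (\<eta> x) = \<phi> x) \<longrightarrow>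
             (\<forall>y\<in>carrier C. h' y = h y))))"
    by (simp only: is_colimit_def mor simp_thms)
  also have "\<dots> \<longleftrightarrow> (\<forall>G \<phi>. profinite_group G \<and> group_ifun_mor A P (Delta A G) \<phi> \<longrightarrow> uni G (fst \<circ> \<phi>))"
  proof (intro iff_allI imp_cong refl)
    fix G :: "'g pgrp" and \<phi>
    assume "profinite_group G \<and> group_ifun_mor A P (Delta A G) \<phi>"
    then have "Delta_map h (\<eta> x) = \<phi> x \<longleftrightarrow> h (fst (\<eta> x)) = fst (\<phi> x)" if "x \<in> topspace (tot P)" for h x
      using that C group_ifun_mor_Delta_iff[OF P, of G \<phi>] by (auto simp: prod_eq_iff)
    then show "(\<exists>h. pgrp_hom C G h \<and> (\<forall>x\<in>topspace (tot P). Delta_map h (\<eta> x) = \<phi> x) \<and>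
          (\<forall>h'. pgrp_hom C G h' \<and> (\<forall>x\<in>topspace (tot P). Delta_map h' (\<eta> x) = \<phi> x) \<longrightarrow>
             (\<forall>y\<in>carrier C. h' y = h y))) = uni G (fst \<circ> \<phi>)"
      unfolding uni_def o_apply by (simp cong: ball_cong)
  qed
  also have "\<dots> \<longleftrightarrow> (\<forall>G c. profinite_group G \<and> cone A P G c \<longrightarrow> uni G c)"
  proof (intro iffI allI impI)
    fix G :: "'g pgrp" and c
    assume *: "\<forall>G \<phi>. profinite_group G \<and> group_ifun_mor A P (Delta A G) \<phi> \<longrightarrow> uni G (fst \<circ> \<phi>)"
      and "profinite_group G \<and> cone A P G c"
    then show "uni G c"
      \<comment> \<open>A cone becomes a morphism to the constant diagram by pairing it with the
        base map.\<close>
      using *[rule_format, of G "\<lambda>x. (c x, base P x)"] group_ifun_mor_Delta_iff[OF P, of G]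
      by (simp add: o_def)
  qed (use group_ifun_mor_Delta_iff[OF P] in blast)
  also have "\<dots> \<longleftrightarrow> ?R"
    using C by (simp add: universal_cone_def uni_def)
  finally show ?thesis .
qed

lemma cone_in_carrier:
  assumes "profinite_group G" "cone A P G c" "x \<in> topspace (tot P)"
  shows "c x \<in> carrier G"
  using assms continuous_map_image_subset_topspace[of "tot P" "gtop G" c]
  by (auto simp: cone_def profinite_group_def)

lemma cone_mult:
  assumes "cone A P G c" "x \<in> topspace (tot P)" "y \<in> topspace (tot P)" "base P x = base P y"
  shows "c (gmul P (x, y)) = c x \<otimes>\<^bsub>G\<^esub> c y"
  using assms by (simp add: cone_def)

text \<open>The value at the unit of a fibre is idempotent, hence the unit of \<open>G\<close>, so a
  cone takes fibrewise inverses to inverses. This provides the hypothesis on inverses in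
  \<open>closure_generate_ample\<close>.\<close>

lemma cone_inv:
  assumes P: "group_ifun A P" and G: "profinite_group G" and c: "cone A P G c"
    and x: "x \<in> topspace (tot P)"
  shows "inv\<^bsub>G\<^esub> c x \<in> c ` topspace (tot P)"
proof -
  interpret group G using G by (simp add: profinite_group_def)
  define a where "a = base P x"
  have a: "a \<in> topspace (Ob A)" using group_ifun_base(2)[OF P x] by (simp add: a_def)
  then have "group (fibre P a)" using P by (simp add: group_ifun_def)
  then have "gone P a \<in> carrier (fibre P a)" "gmul P (gone P a, gone P a) = gone P a"
    using monoid.one_closed[of "fibre P a"] monoid.l_one[of "fibre P a" "gone P a"]
      group.is_monoid[of "fibre P a"]
    by simp_all
  moreover from this have "c (gmul P (gone P a, gone P a)) = c (gone P a) \<otimes>\<^bsub>G\<^esub> c (gone P a)"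
    by (intro cone_mult[OF c]) simp_all
  ultimately have "c (gone P a) = \<one>\<^bsub>G\<^esub>"
    using cone_in_carrier[OF G c, of "gone P a"] by (simp add: r_cancel_one')
  moreover have i: "ginv P x \<in> carrier (fibre P a)" "gmul P (ginv P x, x) = gone P a"
    using P a x by (simp_all add: group_ifun_def a_def)
  ultimately have "c (ginv P x) \<otimes>\<^bsub>G\<^esub> c x = \<one>\<^bsub>G\<^esub>"
    using cone_mult[OF c, of "ginv P x" x] x by (simp add: a_def)
  then have "inv\<^bsub>G\<^esub> c x = c (ginv P x)"
    using cone_in_carrier[OF G c] i x by (intro inv_equality) auto
  then show ?thesis using i by auto
qed

lemma cone_comp:
  assumes "profinite_group G" "cone A P G c" "pgrp_hom G H h"
  shows "cone A P H (\<lambda>x. h (c x))"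
proof -
  have "continuous_map (tot P) (gtop H) (h \<circ> c)"
    using assms continuous_map_compose by (auto simp: cone_def pgrp_hom_def)
  then show ?thesis
    using assms cone_in_carrier[OF assms(1,2)] by (simp add: cone_def pgrp_hom_def hom_mult o_def)
qed

text \<open>Both homomorphisms solve the factorisation problem of the same cone. The argument
  reaches only targets over the tested type.\<close>

lemma universal_cone_hom_eq:
  fixes G :: "'g pgrp"
  assumes univ: "universal_cone TYPE('g) A P C d" and G: "profinite_group G"
    and h: "pgrp_hom C G h" "pgrp_hom C G h'"
    and eq: "\<And>x. x \<in> topspace (tot P) \<Longrightarrow> h (d x) = h' (d x)" and y: "y \<in> carrier C"
  shows "h y = h' y"
proof -
  have "cone A P G (\<lambda>x. h (d x))"
    by (rule cone_comp[OF _ _ h(1)]) (use univ in \<open>simp_all add: universal_cone_def\<close>)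
  then obtain k where k: "\<And>h'. pgrp_hom C G h' \<Longrightarrow> (\<forall>x\<in>topspace (tot P). h' (d x) = h (d x)) \<Longrightarrow>
      (\<forall>y\<in>carrier C. h' y = k y)"
    using univ G unfolding universal_cone_def by meson
  have *: "\<forall>x\<in>topspace (tot P). h' (d x) = h (d x)" using eq by simp
  show ?thesis
    using bspec[OF k[OF h(1) ballI[OF refl]] y] bspec[OF k[OF h(2) *] y] by simp
qed

lemma cone_sub_copy:
  assumes G: "profinite_group G" "subgroup H G" "closedin (gtop G) H" "inj_on e H"
    and c: "cone A P G c" "c ` topspace (tot P) \<subseteq> H"
  shows "cone A P (sub_copy G H e) (\<lambda>x. e (c x))"
  using c continuous_map_into_sub_copy[OF G, of "tot P" c]
  by (auto simp: cone_def sub_copy_simps[OF G] o_def image_subset_iff)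

lemma universal_cone_exists:
  fixes P :: "('o, 'm, 'p) igrp"
  assumes P: "group_ifun A P"
  shows "\<exists>(C :: 'p ample pgrp) d. universal_cone TYPE('p ample) A P C d"
proof -
  let ?X = "topspace (tot P)"
  \<comment> \<open>With the element type fixed, all groups together with all cones into them form a
    set. The coordinate of \<open>d\<close> at \<open>(G, c)\<close> will be \<open>c\<close>
    itself.\<close>
  define I where "I = {(G :: 'p ample pgrp, c). profinite_group G \<and> cone A P G c}"
  define Q where "Q = prod_pgrp I fst"
  define d where "d x = (\<lambda>i\<in>I. snd i x)" for x
  have Q: "profinite_group Q"
    unfolding Q_def by (rule profinite_group_prod) (auto simp: I_def)
  have coord: "cone A P (fst i) (snd i)" if "i \<in> I" for i
    using that by (auto simp: I_def)
  have "continuous_map (tot P) (gtop Q) d"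
    using coord by (auto simp: Q_def d_def continuous_map_componentwise cone_def)
  moreover have "d (gmul P (x, y)) = d x \<otimes>\<^bsub>Q\<^esub> d y"
    if "x \<in> ?X" "y \<in> ?X" "base P x = base P y" for x y
    unfolding Q_def d_def prod_pgrp_simps
    by (rule restrict_ext) (use coord that in \<open>simp add: cone_def\<close>)
  moreover have "d (act P (f, x)) = d x"
    if "f \<in> topspace (Arr A)" "x \<in> ?X" "src A f = base P x" for f x
    unfolding d_def by (rule restrict_ext) (use coord that in \<open>simp add: cone_def\<close>)
  ultimately have cone: "cone A P Q d"
    by (simp add: cone_def)
  have dX: "d ` ?X \<subseteq> carrier Q" using cone_in_carrier[OF Q cone] by auto
  define H where "H = grp_closure Q (generate Q (d ` ?X))"
  note H = closed_generated[OF Q dX, folded H_def]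
  \<comment> \<open>Elements of \<open>Q\<close> are functions on \<open>I\<close>; \<open>e\<close>
    brings the closed subgroup generated by the cone back into \<open>'p ample\<close>.\<close>
  obtain e :: "_ \<Rightarrow> 'p ample" where e: "inj_on e H"
    using closure_generate_ample[OF Q dX cone_inv[OF P Q cone]] H_def by blast
  note sub = Q H(1,2) e
  let ?C = "sub_copy Q H e"
  have C: "profinite_group ?C" by (rule profinite_group_sub_copy[OF sub])
  have gen: "topologically_generates ?C (e ` d ` ?X)"
    by (rule topologically_generates_sub_copy[OF sub H(3) H_def])
  have "\<exists>h. pgrp_hom ?C G h \<and> (\<forall>x\<in>?X. h (e (d x)) = c x) \<and>
      (\<forall>h'. pgrp_hom ?C G h' \<and> (\<forall>x\<in>?X. h' (e (d x)) = c x) \<longrightarrow> (\<forall>y\<in>carrier ?C. h' y = h y))"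
    if G: "profinite_group G" and c: "cone A P G c" for G :: "'p ample pgrp" and c
  proof -
    have i: "(G, c) \<in> I" using that by (simp add: I_def)
    \<comment> \<open>The factorisation is the projection to the coordinate indexed by the given
      group and cone. Its uniqueness will come from generation.\<close>
    have "pgrp_hom Q G (\<lambda>x. x (G, c))"
      using i continuous_map_product_projection[OF i, of "\<lambda>i. gtop (fst i)"]
      by (auto simp: Q_def pgrp_hom_def hom_def dest: PiE_mem[OF _ i])
    then have h: "pgrp_hom ?C G ((\<lambda>x. x (G, c)) \<circ> inv_into H e)"
      by (rule pgrp_hom_comp[OF pgrp_hom_sub_copy_inv[OF sub]])
    have hd: "((\<lambda>x. x (G, c)) \<circ> inv_into H e) (e (d x)) = c x" if "x \<in> ?X" for x
      using that H(3) e i by (auto simp: d_def)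
    show ?thesis
    proof (intro exI conjI allI ballI impI)
      show "pgrp_hom ?C G ((\<lambda>x. x (G, c)) \<circ> inv_into H e)" by (rule h)
      show "((\<lambda>x. x (G, c)) \<circ> inv_into H e) (e (d x)) = c x" if "x \<in> ?X" for x by (rule hd[OF that])
      fix k y assume k: "pgrp_hom ?C G k \<and> (\<forall>x\<in>?X. k (e (d x)) = c x)" and y: "y \<in> carrier ?C"
      show "k y = ((\<lambda>x. x (G, c)) \<circ> inv_into H e) y"
        by (rule pgrp_hom_eq_on_generators[OF C G _ h gen _ y]) (use k hd in auto)
    qed
  qed
  then have "universal_cone TYPE('p ample) A P ?C (\<lambda>x. e (d x))"
    using C cone_sub_copy[OF sub cone H(3)] by (simp add: universal_cone_def)
  then show ?thesis by blast
qed

text \<open>The cone corestricts to any closed subgroup \<open>M\<close> containing its image, which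
  yields a homomorphism from \<open>C\<close> to \<open>M\<close>. Followed by the inclusion it
  agrees with the identity on the cone, so it is the identity and \<open>M\<close> is everything.
  Since only groups over \<open>'x\<close> are tested, \<open>M\<close> and \<open>C\<close> are
  replaced by their copies along \<open>j\<close>.\<close>

lemma universal_cone_generates:
  fixes C :: "'c pgrp" and j :: "'c \<Rightarrow> 'x"
  assumes univ: "universal_cone TYPE('x) A P C d" and j: "inj j"
  shows "topologically_generates C (d ` topspace (tot P))"
  unfolding topologically_generates_def
proof (intro conjI allI impI)
  have C: "profinite_group C" and d: "cone A P C d"
    using univ by (auto simp: universal_cone_def)
  interpret group C using C by (simp add: profinite_group_def)
  show "d ` topspace (tot P) \<subseteq> carrier C" using cone_in_carrier[OF C d] by auto
  fix M assume M: "subgroup M C \<and> closedin (gtop C) M \<and> d ` topspace (tot P) \<subseteq> M"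
  have jM: "inj_on j M" and jC: "inj_on j (carrier C)" using j by (auto intro: inj_on_subset)
  have clC: "closedin (gtop C) (carrier C)"
    using C closedin_topspace[of "gtop C"] by (simp add: profinite_group_def)
  note subM = C conjunct1[OF M] conjunct1[OF conjunct2[OF M]] jM
  note subC = C subgroup_self clC jC
  \<comment> \<open>In the copy \<open>?K\<close> of the whole group, \<open>j\<close> plays the
    role of the identity and \<open>h\<close> that of the retraction followed by the
    inclusion.\<close>
  let ?K = "sub_copy C (carrier C) j"
  have K: "profinite_group ?K" by (rule profinite_group_sub_copy[OF subC])
  obtain h where h: "pgrp_hom C (sub_copy C M j) h" and hd: "\<And>x. x \<in> topspace (tot P) \<Longrightarrow> h (d x) = j (d x)"
    using universal_coneE[OF univ profinite_group_sub_copy[OF subM] cone_sub_copy[OF subM d]] M by metis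
  have h_in: "h y \<in> j ` M" if "y \<in> carrier C" for y
    using h that by (auto simp: pgrp_hom_def hom_def sub_copy_simps[OF subM])
  have jK: "pgrp_hom C ?K j"
    using continuous_map_into_sub_copy[OF subC continuous_map_id] C
    by (auto simp: pgrp_hom_def hom_def sub_copy_simps[OF subC] profinite_group_def)
  \<comment> \<open>Going back from the copy of \<open>M\<close> into \<open>C\<close> and then into
    \<open>?K\<close> changes no values, but shows that \<open>h\<close> is a homomorphism into
    \<open>?K\<close>.\<close>
  have "pgrp_hom C ?K (j \<circ> (inv_into M j \<circ> h))"
    using pgrp_hom_comp[OF pgrp_hom_comp[OF h pgrp_hom_sub_copy_inv[OF subM]] jK] by (simp add: o_assoc)
  moreover have "(j \<circ> (inv_into M j \<circ> h)) y = h y" if "y \<in> carrier C" for y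
    using h_in[OF that] by (simp add: f_inv_into_f)
  ultimately have hK: "pgrp_hom C ?K h"
    by (rule pgrp_hom_eq[OF C])
  have "j y = h y" if "y \<in> carrier C" for y
    by (rule universal_cone_hom_eq[OF univ K jK hK _ that]) (simp add: hd)
  then have "y \<in> M" if "y \<in> carrier C" for y
    using h_in[OF that] that j by (metis (no_types, lifting) image_iff injD)
  then show "M = carrier C" using M subgroup.subset by blast
qed

text \<open>A cone corestricts to the closed subgroup that it generates, and this subgroup has a copy
  inside every type that is at least as large as \<open>'p ample\<close>.\<close>

lemma universal_cone_transfer:
  fixes C :: "'c pgrp" and j :: "'c \<Rightarrow> 'x" and P :: "('o, 'm, 'p) igrp" and k :: "'p ample \<Rightarrow> 'x"
  assumes P: "group_ifun A P" and univ: "universal_cone TYPE('x) A P C d" and j: "inj j" and k: "inj k"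
  shows "universal_cone TYPE('g) A P C d"
proof -
  let ?X = "topspace (tot P)"
  have C: "profinite_group C" and d: "cone A P C d"
    using univ by (auto simp: universal_cone_def)
  have gen: "topologically_generates C (d ` ?X)" by (rule universal_cone_generates[OF univ j])
  have "\<exists>h. pgrp_hom C G h \<and> (\<forall>x\<in>?X. h (d x) = c x) \<and>
      (\<forall>h'. pgrp_hom C G h' \<and> (\<forall>x\<in>?X. h' (d x) = c x) \<longrightarrow> (\<forall>y\<in>carrier C. h' y = h y))"
    if G: "profinite_group G" and c: "cone A P G c" for G :: "'g pgrp" and c
  proof -
    have cX: "c ` ?X \<subseteq> carrier G" using cone_in_carrier[OF G c] by auto
    define H where "H = grp_closure G (generate G (c ` ?X))"
    note H = closed_generated[OF G cX, folded H_def]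
    obtain e :: "'g \<Rightarrow> 'p ample" where e: "inj_on e H"
      using closure_generate_ample[OF G cX cone_inv[OF P G c]] H_def by blast
    \<comment> \<open>\<open>k \<circ> e\<close> places the closed subgroup generated by
      \<open>c\<close> in the tested type, whatever \<open>'g\<close> is; the factorisation found
      there is carried back along the inverse.\<close>
    then have ke: "inj_on (k \<circ> e) H" using k by (auto intro: comp_inj_on inj_on_subset)
    note sub = G H(1,2) ke
    obtain h where h: "pgrp_hom C (sub_copy G H (k \<circ> e)) h"
        and hd: "\<And>x. x \<in> ?X \<Longrightarrow> h (d x) = (k \<circ> e) (c x)"
      using universal_coneE[OF univ profinite_group_sub_copy[OF sub] cone_sub_copy[OF sub c H(3)]] by blast
    let ?h = "inv_into H (k \<circ> e) \<circ> h"
    have h': "pgrp_hom C G ?h"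
      by (rule pgrp_hom_comp[OF h pgrp_hom_sub_copy_inv[OF sub]])
    have hd': "?h (d x) = c x" if "x \<in> ?X" for x
      using that H(3) hd[OF that] inv_into_f_f[OF ke, of "c x"] by auto
    show ?thesis
    proof (intro exI conjI allI ballI impI)
      show "pgrp_hom C G ?h" by (rule h')
      show "?h (d x) = c x" if "x \<in> ?X" for x by (rule hd'[OF that])
      fix k y assume k: "pgrp_hom C G k \<and> (\<forall>x\<in>?X. k (d x) = c x)" and y: "y \<in> carrier C"
      \<comment> \<open>Universality was assumed only for groups over \<open>'x\<close>, so
        uniqueness for a target over \<open>'g\<close> comes from generation.\<close>
      show "k y = ?h y"
        by (rule pgrp_hom_eq_on_generators[OF C G _ h' gen _ y]) (use k hd' in auto)
    qed
  qed
  then show ?thesis using C d by (simp add: universal_cone_def)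
qed

section \<open>Coequalisers of free products\<close>

lemma is_colimit_transfer:
  fixes C :: "'c pgrp" and j :: "'c \<Rightarrow> 'x" and P :: "('o, 'm, 'p) igrp" and k :: "'p ample \<Rightarrow> 'x"
  assumes "group_ifun A P" "is_colimit TYPE('x) A P C \<eta>" "inj j" "inj k"
  shows "is_colimit TYPE('g) A P C \<eta>"
  using assms universal_cone_transfer[OF assms(1) _ assms(3,4), where 'g='g] by (simp add: is_colimit_iff)

lemma inj_ample_map:
  assumes "inj f"
  shows "inj (image (image (map f)))"
  using assms by (simp add: inj_image_eq_iff inj_def)

section \<open>The families over objects and arrows as diagrams on discrete categories\<close>

lemma discrete_icat_simps [simp]:
  "Ob (discrete_icat X) = X" "Arr (discrete_icat X) = X" "src (discrete_icat X) = id"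
  "tgt (discrete_icat X) = id" "idn (discrete_icat X) = id" "cmp (discrete_icat X) = fst"
  by (simp_all add: discrete_icat_def)

lemma ob_family_simps [simp]:
  "tot (ob_family P) = tot P" "base (ob_family P) = base P" "act (ob_family P) = snd"
  "gmul (ob_family P) = gmul P" "ginv (ob_family P) = ginv P" "gone (ob_family P) = gone P"
  "fibre (ob_family P) = fibre P"
  by (simp_all add: ob_family_def fibre_def fun_eq_iff)

lemma arr_family_simps [simp]:
  "tot (arr_family A P) = fibre_product (Arr A) (tot P) (src A) (base P)"
  "base (arr_family A P) = fst" "act (arr_family A P) = snd"
  "gmul (arr_family A P) (z, w) = (fst z, gmul P (snd z, snd w))"
  "ginv (arr_family A P) z = (fst z, ginv P (snd z))"
  "gone (arr_family A P) f = (f, gone P (src A f))"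
  by (simp_all add: arr_family_def case_prod_unfold)

lemma topspace_fibre_product [simp]:
  "topspace (fibre_product X Y f g) = {(x, y). x \<in> topspace X \<and> y \<in> topspace Y \<and> f x = g y}"
  by (auto simp: fibre_product_def)

lemma continuous_map_fibre_product_projections:
  "continuous_map (fibre_product X Y f g) X fst" "continuous_map (fibre_product X Y f g) Y snd"
  by (simp_all add: fibre_product_def continuous_map_from_subtopology continuous_map_fst continuous_map_snd)

lemma continuous_map_into_fibre_product:
  assumes "continuous_map T X h" "continuous_map T Y k" "\<And>t. t \<in> topspace T \<Longrightarrow> f (h t) = g (k t)"
  shows "continuous_map T (fibre_product X Y f g) (\<lambda>t. (h t, k t))"
  using assms by (auto simp: fibre_product_def continuous_map_in_subtopology continuous_map_paired)

text \<open>The fibre product is the set where two continuous maps into a Hausdorff space agree,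
  hence closed in the product.\<close>

lemma profinite_space_fibre_product:
  assumes "profinite_space X" "profinite_space Y" "Hausdorff_space Z"
    and f: "continuous_map X Z f" and g: "continuous_map Y Z g"
  shows "profinite_space (fibre_product X Y f g)"
proof -
  have "closedin (prod_topology X Y)
      {p \<in> topspace (prod_topology X Y). (f \<circ> fst) p = (g \<circ> snd) p}"
    by (rule closedin_continuous_maps_eq[OF assms(3)])
      (rule continuous_map_compose continuous_map_fst continuous_map_snd f g)+
  moreover have "{p \<in> topspace (prod_topology X Y). (f \<circ> fst) p = (g \<circ> snd) p} =
      topspace (prod_topology X Y) \<inter> {(x, y). f x = g y}"
    by auto
  then have "fibre_product X Y f g =
      subtopology (prod_topology X Y) {p \<in> topspace (prod_topology X Y). (f \<circ> fst) p = (g \<circ> snd) p}"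
    unfolding fibre_product_def by (metis subtopology_restrict)
  ultimately show ?thesis
    using profinite_space_closed_subtopology[OF profinite_space_prod[OF assms(1,2)]] by metis
qed

lemma group_ifun_ob_family:
  assumes P: "group_ifun A P"
  shows "group_ifun (discrete_icat (Ob A)) (ob_family P)"
proof -
  have "id \<in> hom (fibre P a) (fibre P a)" for a
    by (simp add: hom_def)
  then show ?thesis
    using P continuous_map_fibre_product_projections(2)[of "Ob A" "tot P" id "base P"]
    unfolding group_ifun_def internal_functor_def by (simp add: id_def)
qed

lemma is_coequaliserD:
  fixes G :: "'g pgrp"
  assumes "is_coequaliser TYPE('g) R S u v C q" "profinite_group G" "pgrp_hom S G k"
    and uv: "\<And>r. r \<in> carrier R \<Longrightarrow> k (u r) = k (v r)"
  shows "\<exists>h. pgrp_hom C G h \<and> (\<forall>s\<in>carrier S. h (q s) = k s) \<and>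
      (\<forall>h'. pgrp_hom C G h' \<and> (\<forall>s\<in>carrier S. h' (q s) = k s) \<longrightarrow> (\<forall>y\<in>carrier C. h' y = h y))"
proof -
  have "\<forall>r\<in>carrier R. k (u r) = k (v r)" using uv by blast
  with assms(1-3) show ?thesis
    unfolding is_coequaliser_def by blast
qed

context
  fixes A :: "('o, 'm) icat" and P :: "('o, 'm, 'p) igrp"
  assumes A: "internal_category A" and P: "group_ifun A P"
begin

lemma src_closed: "f \<in> topspace (Arr A) \<Longrightarrow> src A f \<in> topspace (Ob A)"
  using A continuous_map_image_subset_topspace[of "Arr A" "Ob A" "src A"]
  by (auto simp: internal_category_def)

lemma group_fibre: "a \<in> topspace (Ob A) \<Longrightarrow> group (fibre P a)"
  using P by (simp add: group_ifun_def)

lemma gmul_closed: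
  assumes "x \<in> topspace (tot P)" "y \<in> topspace (tot P)" "base P x = base P y"
  shows "gmul P (x, y) \<in> topspace (tot P)" "base P (gmul P (x, y)) = base P y"
  using monoid.m_closed[OF group.is_monoid[OF group_fibre[OF group_ifun_base(2)[OF P assms(1)]]], of x y] assms
  by simp_all

lemma act_closed:
  assumes "f \<in> topspace (Arr A)" "x \<in> topspace (tot P)" "src A f = base P x"
  shows "act P (f, x) \<in> topspace (tot P)"
  using P assms
    continuous_map_image_subset_topspace[of "fibre_product (Arr A) (tot P) (src A) (base P)" "tot P" "act P"]
  by (auto simp: group_ifun_def internal_functor_def)

text \<open>\<open>Pair f\<close> identifies the fibre of \<open>P\<close> at the source of
  \<open>f\<close> with the fibre over \<open>f\<close>, so the group laws carry over.\<close>

lemma group_fibre_arr_family: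
  assumes f: "f \<in> topspace (Arr A)"
  shows "group (fibre (arr_family A P) f)"
proof -
  let ?E = "fibre (arr_family A P) f" and ?F = "fibre P (src A f)"
  have car: "carrier ?E = Pair f ` carrier ?F"
    using f by auto
  have mult: "(f, x) \<otimes>\<^bsub>?E\<^esub> (f, y) = (f, x \<otimes>\<^bsub>?F\<^esub> y)" for x y
    by simp
  have one: "\<one>\<^bsub>?E\<^esub> = (f, \<one>\<^bsub>?F\<^esub>)"
    by simp
  interpret group ?F by (rule group_fibre[OF src_closed[OF f]])
  show ?thesis
  proof (rule groupI)
    fix z assume "z \<in> carrier ?E"
    then obtain x where x: "x \<in> carrier ?F" "z = (f, x)" unfolding car by blast
    show "\<exists>w\<in>carrier ?E. w \<otimes>\<^bsub>?E\<^esub> z = \<one>\<^bsub>?E\<^esub>"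
    proof (rule bexI)
      show "(f, inv\<^bsub>?F\<^esub> x) \<otimes>\<^bsub>?E\<^esub> z = \<one>\<^bsub>?E\<^esub>"
        unfolding x(2) mult one l_inv[OF x(1)] ..
      show "(f, inv\<^bsub>?F\<^esub> x) \<in> carrier ?E"
        unfolding car using inv_closed[OF x(1)] by (rule imageI)
    qed
  \<comment> \<open>\<open>fibre_simps\<close> is switched off so that the operations of
    \<open>?F\<close> stay folded and match its group laws.\<close>
  qed (unfold car one, auto simp: mult m_assoc simp del: fibre_simps)
qed

lemma group_ifun_arr_family: "group_ifun (discrete_icat (Arr A)) (arr_family A P)"
proof -
  let ?T = "fibre_product (Arr A) (tot P) (src A) (base P)"
  note proj = continuous_map_fibre_product_projections
  have cont: "continuous_map (fibre_product (tot P) (tot P) (base P) (base P)) (tot P) (gmul P)"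
    "continuous_map (tot P) (tot P) (ginv P)" "continuous_map (Ob A) (tot P) (gone P)"
    "continuous_map (Arr A) (Ob A) (src A)"
    using P A by (auto simp: group_ifun_def internal_category_def)
  have "profinite_space ?T"
    using A P by (intro profinite_space_fibre_product[where Z="Ob A"])
      (auto simp: internal_category_def group_ifun_def internal_functor_def profinite_space_def)
  moreover have "continuous_map (fibre_product ?T ?T fst fst) ?T (\<lambda>p. (fst (fst p), gmul P (snd (fst p), snd (snd p))))"
  proof (rule continuous_map_into_fibre_product)
    show "continuous_map (fibre_product ?T ?T fst fst) (Arr A) (\<lambda>p. fst (fst p))"
      using continuous_map_compose[OF proj(1) proj(1)] by (simp add: o_def)
    have "continuous_map (fibre_product ?T ?T fst fst) (fibre_product (tot P) (tot P) (base P) (base P))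
        (\<lambda>p. (snd (fst p), snd (snd p)))"
      using continuous_map_compose[OF proj(1) proj(2)] continuous_map_compose[OF proj(2) proj(2)]
      by (intro continuous_map_into_fibre_product) (auto simp: o_def)
    from continuous_map_compose[OF this cont(1)]
    show "continuous_map (fibre_product ?T ?T fst fst) (tot P) (\<lambda>p. gmul P (snd (fst p), snd (snd p)))"
      by (simp add: o_def)
  qed (auto simp: gmul_closed)
  then have "continuous_map (fibre_product ?T ?T fst fst) ?T (gmul (arr_family A P))"
    by (rule continuous_map_eq) auto
  moreover have ginv: "ginv P x \<in> topspace (tot P)" "base P (ginv P x) = base P x"
      "gmul P (ginv P x, x) = gone P (base P x)" if "x \<in> topspace (tot P)" for x
    using P that group_ifun_base(2)[OF P that] by (auto simp: group_ifun_def)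
  have "continuous_map ?T ?T (\<lambda>z. (fst z, ginv P (snd z)))"
    using proj continuous_map_compose[OF proj(2) cont(2)]
    by (intro continuous_map_into_fibre_product) (auto simp: o_def ginv)
  then have "continuous_map ?T ?T (ginv (arr_family A P))"
    by (rule continuous_map_eq) simp
  moreover have gone: "base P (gone P a) = a" if "a \<in> topspace (Ob A)" for a
    using monoid.one_closed[OF group.is_monoid[OF group_fibre[OF that]]] by simp
  have "continuous_map (Arr A) ?T (\<lambda>f. (f, gone P (src A f)))"
    using continuous_map_compose[OF cont(4) cont(3)]
    by (intro continuous_map_into_fibre_product) (auto simp: o_def gone src_closed)
  then have "continuous_map (Arr A) ?T (gone (arr_family A P))"
    by (rule continuous_map_eq) simp
  moreover have "id \<in> hom (fibre (arr_family A P) f) (fibre (arr_family A P) f)" for f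
    by (simp add: hom_def)
  ultimately show ?thesis
    using proj(1)[of "Arr A" "tot P"] proj(2)[of "Arr A" ?T id fst] group_fibre_arr_family
    unfolding group_ifun_def internal_functor_def by (auto simp: id_def ginv)
qed

text \<open>Over the discrete category the action is a projection, so invariance is automatic there.
  The remaining condition is the one that the coequaliser imposes.\<close>

lemma cone_ob_family_iff:
  "cone A P G c \<longleftrightarrow> cone (discrete_icat (Ob A)) (ob_family P) G c \<and>
    (\<forall>f\<in>topspace (Arr A). \<forall>x\<in>topspace (tot P). src A f = base P x \<longrightarrow> c (act P (f, x)) = c x)"
  by (auto simp: cone_def)

text \<open>Applied to the universal cone over the objects, these two cones induce \<open>u\<close>
  and \<open>v\<close>. The second respects products because every arrow acts by a
  homomorphism.\<close>

lemma cone_arr_family: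
  assumes c: "cone (discrete_icat (Ob A)) (ob_family P) G c"
  shows "cone (discrete_icat (Arr A)) (arr_family A P) G (\<lambda>z. c (snd z))"
    "cone (discrete_icat (Arr A)) (arr_family A P) G (\<lambda>z. c (act P z))"
proof -
  let ?T = "fibre_product (Arr A) (tot P) (src A) (base P)"
  have cont: "continuous_map (tot P) (gtop G) c"
    and mult: "\<And>x y. x \<in> topspace (tot P) \<Longrightarrow> y \<in> topspace (tot P) \<Longrightarrow> base P x = base P y \<Longrightarrow>
      c (gmul P (x, y)) = c x \<otimes>\<^bsub>G\<^esub> c y"
    using c by (simp_all add: cone_def)
  have act: "continuous_map ?T (tot P) (act P)"
    using P by (simp add: group_ifun_def internal_functor_def)
  have act_mult: "act P (f, gmul P (x, y)) = gmul P (act P (f, x), act P (f, y))"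
    if "f \<in> topspace (Arr A)" "x \<in> topspace (tot P)" "y \<in> topspace (tot P)" "src A f = base P x" "src A f = base P y"
    for f x y
  proof -
    have "(\<lambda>x. act P (f, x)) \<in> hom (fibre P (src A f)) (fibre P (tgt A f))"
      using P that(1) by (simp add: group_ifun_def)
    from hom_mult[OF this, of x y] show ?thesis using that by simp
  qed
  have "continuous_map ?T (gtop G) (\<lambda>z. c (snd z))"
    using continuous_map_compose[OF continuous_map_fibre_product_projections(2) cont] by (simp add: o_def)
  then show "cone (discrete_icat (Arr A)) (arr_family A P) G (\<lambda>z. c (snd z))"
    by (auto simp: cone_def intro!: mult)
  have "continuous_map ?T (gtop G) (\<lambda>z. c (act P z))"
    using continuous_map_compose[OF act cont] by (simp add: o_def)
  then show "cone (discrete_icat (Arr A)) (arr_family A P) G (\<lambda>z. c (act P z))"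
    by (auto simp: cone_def act_mult act_closed group_ifun_base(3)[OF P] intro!: mult)
qed

section \<open>Universal cones on \<open>P\<close> versus coequalisers of free products\<close>

context
  fixes S0 :: "'s0 pgrp" and S1 :: "'s1 pgrp" and d0 :: "'p \<Rightarrow> 's0" and d1 :: "'m \<times> 'p \<Rightarrow> 's1"
    and u v :: "'s1 \<Rightarrow> 's0" and C :: "'c pgrp" and q :: "'s0 \<Rightarrow> 'c"
  assumes u: "pgrp_hom S1 S0 u" and v: "pgrp_hom S1 S0 v"
    and uv: "\<And>f x. f \<in> topspace (Arr A) \<Longrightarrow> x \<in> topspace (tot P) \<Longrightarrow> src A f = base P x \<Longrightarrow>
      u (d1 (f, x)) = d0 x \<and> v (d1 (f, x)) = d0 (act P (f, x))"
begin

text \<open>The equation \<open>k (u r) = k (v r)\<close> at \<open>r = d1 (f, x)\<close> is exactly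
  invariance under \<open>f\<close> at \<open>x\<close>.\<close>

lemma cone_coequalising:
  assumes d0: "profinite_group S0" "cone (discrete_icat (Ob A)) (ob_family P) S0 d0"
    and d1: "profinite_group S1" "cone (discrete_icat (Arr A)) (arr_family A P) S1 d1"
    and k: "pgrp_hom S0 G k" "\<And>r. r \<in> carrier S1 \<Longrightarrow> k (u r) = k (v r)"
  shows "cone A P G (\<lambda>x. k (d0 x))"
  unfolding cone_ob_family_iff
proof (intro conjI ballI impI)
  show "cone (discrete_icat (Ob A)) (ob_family P) G (\<lambda>x. k (d0 x))"
    by (rule cone_comp[OF d0 k(1)])
  fix f x assume *: "f \<in> topspace (Arr A)" "x \<in> topspace (tot P)" "src A f = base P x"
  then have "d1 (f, x) \<in> carrier S1"
    by (intro cone_in_carrier[OF d1]) simp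
  from k(2)[OF this] show "k (d0 (act P (f, x))) = k (d0 x)"
    using uv[OF *] by simp
qed

lemma universal_cone_of_coequaliser:
  assumes S0: "universal_cone TYPE('g) (discrete_icat (Ob A)) (ob_family P) S0 d0"
    and S1: "universal_cone TYPE('g) (discrete_icat (Arr A)) (arr_family A P) S1 d1"
    and coeq: "is_coequaliser TYPE('g) S1 S0 u v C q"
  shows "universal_cone TYPE('g) A P C (\<lambda>x. q (d0 x))"
proof -
  have g0: "profinite_group S0" and d0: "cone (discrete_icat (Ob A)) (ob_family P) S0 d0"
    using S0 by (auto simp: universal_cone_def)
  have g1: "profinite_group S1" and d1: "cone (discrete_icat (Arr A)) (arr_family A P) S1 d1"
    using S1 by (auto simp: universal_cone_def)
  have C: "profinite_group C" and q: "pgrp_hom S0 C q" "\<And>r. r \<in> carrier S1 \<Longrightarrow> q (u r) = q (v r)"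
    using coeq by (auto simp: is_coequaliser_def)
  have d0_in: "d0 x \<in> carrier S0" if "x \<in> topspace (tot P)" for x
    using cone_in_carrier[OF g0 d0] that by simp
  have "\<exists>h. pgrp_hom C G h \<and> (\<forall>x\<in>topspace (tot P). h (q (d0 x)) = c x) \<and>
      (\<forall>h'. pgrp_hom C G h' \<and> (\<forall>x\<in>topspace (tot P). h' (q (d0 x)) = c x) \<longrightarrow>
        (\<forall>y\<in>carrier C. h' y = h y))"
    if G: "profinite_group G" and c: "cone A P G c" for G :: "'g pgrp" and c
  proof -
    obtain k where k: "pgrp_hom S0 G k" and kd: "\<And>x. x \<in> topspace (tot P) \<Longrightarrow> k (d0 x) = c x"
      using universal_coneE[OF S0 G, of c] c by (auto simp: cone_ob_family_iff)
    \<comment> \<open>Homomorphisms out of \<open>S1\<close> are determined by their values on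
      \<open>d1\<close>, and there the equation is the invariance of \<open>c\<close>.\<close>
    have "(k \<circ> u) r = (k \<circ> v) r" if "r \<in> carrier S1" for r
    proof (rule universal_cone_hom_eq[OF S1 G pgrp_hom_comp[OF u k] pgrp_hom_comp[OF v k] _ that])
      fix z assume "z \<in> topspace (tot (arr_family A P))"
      then show "(k \<circ> u) (d1 z) = (k \<circ> v) (d1 z)"
        using uv c by (auto simp: kd act_closed cone_def)
    qed
    then have kuv: "k (u r) = k (v r)" if "r \<in> carrier S1" for r
      using that by simp
    obtain h where h: "pgrp_hom C G h" "\<forall>s\<in>carrier S0. h (q s) = k s"
      and unique: "\<forall>h'. pgrp_hom C G h' \<and> (\<forall>s\<in>carrier S0. h' (q s) = k s) \<longrightarrow> (\<forall>y\<in>carrier C. h' y = h y)"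
      using is_coequaliserD[OF coeq G k kuv] by blast
    have "h' y = h y"
      if h': "pgrp_hom C G h'" "\<forall>x\<in>topspace (tot P). h' (q (d0 x)) = c x" and y: "y \<in> carrier C" for h' y
    proof (rule unique[rule_format, OF conjI[OF h'(1) ballI] y])
      fix s assume s: "s \<in> carrier S0"
      \<comment> \<open>Both sides restrict to \<open>c\<close> along \<open>d0\<close>, so they
        agree on all of \<open>S0\<close>, and the uniqueness clause of the coequaliser applies to
        \<open>h'\<close>.\<close>
      have "(h' \<circ> q) s = k s"
        by (rule universal_cone_hom_eq[OF S0 G pgrp_hom_comp[OF q(1) h'(1)] k _ s]) (use h'(2) kd in auto)
      then show "h' (q s) = k s" by simp
    qed
    moreover have "h (q (d0 x)) = c x" if "x \<in> topspace (tot P)" for x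
      using bspec[OF h(2) d0_in[OF that]] kd[OF that] by simp
    ultimately show ?thesis using h(1) by blast
  qed
  then show ?thesis
    using C cone_coequalising[OF g0 d0 g1 d1 q] by (simp add: universal_cone_def)
qed

text \<open>This direction produces coequalisers without quotients. A homomorphism \<open>k\<close>
  that coequalises \<open>u\<close> and \<open>v\<close> restricts along \<open>d0\<close> to a cone
  on \<open>P\<close>, which factors through \<open>C\<close>; the equation
  \<open>h \<circ> q = k\<close> then spreads from the image of \<open>d0\<close> to
  \<open>S0\<close> by universality.\<close>

lemma is_coequaliser_of_universal_cone:
  assumes S0: "universal_cone TYPE('g) (discrete_icat (Ob A)) (ob_family P) S0 d0"
    and d1: "profinite_group S1" "cone (discrete_icat (Arr A)) (arr_family A P) S1 d1"
    and C: "universal_cone TYPE('g) A P C (\<lambda>x. q (d0 x))"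
    and q: "pgrp_hom S0 C q" "\<And>r. r \<in> carrier S1 \<Longrightarrow> q (u r) = q (v r)"
  shows "is_coequaliser TYPE('g) S1 S0 u v C q"
proof -
  have g0: "profinite_group S0" and d0: "cone (discrete_icat (Ob A)) (ob_family P) S0 d0"
    using S0 by (auto simp: universal_cone_def)
  have d0_in: "d0 x \<in> carrier S0" if "x \<in> topspace (tot P)" for x
    using cone_in_carrier[OF g0 d0] that by simp
  have "\<exists>h. pgrp_hom C G h \<and> (\<forall>s\<in>carrier S0. h (q s) = k s) \<and>
      (\<forall>h'. pgrp_hom C G h' \<and> (\<forall>s\<in>carrier S0. h' (q s) = k s) \<longrightarrow> (\<forall>y\<in>carrier C. h' y = h y))"
    if G: "profinite_group G" and k: "pgrp_hom S0 G k" and kuv: "\<forall>r\<in>carrier S1. k (u r) = k (v r)"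
    for G :: "'g pgrp" and k
  proof -
    have "cone A P G (\<lambda>x. k (d0 x))"
      using cone_coequalising[OF g0 d0 d1 k] kuv by blast
    then obtain h where h: "pgrp_hom C G h" and hd: "\<And>x. x \<in> topspace (tot P) \<Longrightarrow> h (q (d0 x)) = k (d0 x)"
      using universal_coneE[OF C G] by blast
    have "(h \<circ> q) s = k s" if "s \<in> carrier S0" for s
      by (rule universal_cone_hom_eq[OF S0 G pgrp_hom_comp[OF q(1) h] k _ that]) (simp add: hd)
    moreover have "h' y = h y" if "pgrp_hom C G h'" "\<forall>s\<in>carrier S0. h' (q s) = k s" "y \<in> carrier C" for h' y
      by (rule universal_cone_hom_eq[OF C G that(1) h _ that(3)]) (simp add: hd d0_in that(2))
    ultimately show ?thesis
      using h unfolding o_apply by blast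
  qed
  then show ?thesis
    using C q by (simp add: is_coequaliser_def universal_cone_def)
qed

end

end

section \<open>The left adjoint to the constant diagram functor\<close>

lemma cone_precomp:
  assumes P: "group_ifun A P" and t: "group_ifun_mor A P Q t" and c: "cone A Q G c"
  shows "cone A P G (\<lambda>x. c (t x))"
proof -
  have tc: "continuous_map (tot P) (tot Q) t"
    and t_base: "\<And>x. x \<in> topspace (tot P) \<Longrightarrow> base Q (t x) = base P x"
    and t_act: "\<And>f x. f \<in> topspace (Arr A) \<Longrightarrow> x \<in> topspace (tot P) \<Longrightarrow> src A f = base P x \<Longrightarrow>
      t (act P (f, x)) = act Q (f, t x)"
    using t by (auto simp: group_ifun_mor_def internal_nat_trans_def)
  have t_in: "t x \<in> topspace (tot Q)" if "x \<in> topspace (tot P)" for x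
    using continuous_map_image_subset_topspace[OF tc] that by auto
  have t_mult: "t (gmul P (x, y)) = gmul Q (t x, t y)"
    if "x \<in> topspace (tot P)" "y \<in> topspace (tot P)" "base P x = base P y" for x y
  proof -
    have "t \<in> hom (fibre P (base P x)) (fibre Q (base P x))"
      using t group_ifun_base(2)[OF P that(1)] by (simp add: group_ifun_mor_def)
    from hom_mult[OF this, of x y] that show ?thesis by simp
  qed
  have "continuous_map (tot P) (gtop G) (\<lambda>x. c (t x))"
    using continuous_map_compose[OF tc, of "gtop G" c] c by (simp add: cone_def o_def)
  then show ?thesis
    using c by (simp add: cone_def t_in t_base t_act t_mult)
qed

lemma left_adjoint_to_Delta_exists:
  fixes A :: "('o, 'm) icat"
  shows "\<exists>(L :: ('o, 'm, 'p) igrp \<Rightarrow> 'p ample pgrp) Lm \<eta>. left_adjoint_to_Delta TYPE('p ample) A L Lm \<eta>"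
proof -
  \<comment> \<open>The implication sits inside the existential so that choice yields one function
    defined on all records.\<close>
  have "\<exists>Cd :: 'p ample pgrp \<times> ('p \<Rightarrow> 'p ample). group_ifun A P \<longrightarrow>
      universal_cone TYPE('p ample) A P (fst Cd) (snd Cd)"
    for P :: "('o, 'm, 'p) igrp"
  proof (cases "group_ifun A P")
    case True
    then obtain C :: "'p ample pgrp" and d where "universal_cone TYPE('p ample) A P C d"
      using universal_cone_exists by blast
    then show ?thesis by (intro exI[of _ "(C, d)"]) simp
  qed simp
  then have "\<exists>Cd :: _ \<Rightarrow> 'p ample pgrp \<times> ('p \<Rightarrow> 'p ample). \<forall>P :: ('o, 'm, 'p) igrp. group_ifun A P \<longrightarrow>
      universal_cone TYPE('p ample) A P (fst (Cd P)) (snd (Cd P))"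
    by (intro choice allI)
  then obtain Cd :: "('o, 'm, 'p) igrp \<Rightarrow> 'p ample pgrp \<times> ('p \<Rightarrow> 'p ample)"
    where Cd: "\<And>P. group_ifun A P \<Longrightarrow> universal_cone TYPE('p ample) A P (fst (Cd P)) (snd (Cd P))"
    by blast
  define L where "L P = fst (Cd P)" for P
  define d where "d P = snd (Cd P)" for P
  have univ: "universal_cone TYPE('p ample) A P (L P) (d P)" if "group_ifun A P" for P
    using Cd[OF that] by (simp add: L_def d_def)
  then have L: "profinite_group (L P)" "cone A P (L P) (d P)" if "group_ifun A P" for P
    using that by (auto simp: universal_cone_def)
  define induced where "induced P Q t h \<longleftrightarrow>
    pgrp_hom (L P) (L Q) h \<and> (\<forall>x\<in>topspace (tot P). h (d P x) = d Q (t x))" for P Q t h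
  define Lm where "Lm P Q t = (SOME h. induced P Q t h)" for P Q t
  \<comment> \<open>The hypothesis concerns the transported cone, not \<open>t\<close>, so
    identities and composites need not first be shown to be morphisms.\<close>
  have Lm: "induced P Q t (Lm P Q t)"
    if P: "group_ifun A P" and Q: "group_ifun A Q" and c: "cone A P (L Q) (\<lambda>x. d Q (t x))" for P Q t
  proof -
    obtain h where "pgrp_hom (L P) (L Q) h" "\<And>x. x \<in> topspace (tot P) \<Longrightarrow> h (d P x) = d Q (t x)"
      using universal_coneE[OF univ[OF P] L(1)[OF Q] c] by blast
    then have "induced P Q t h" by (simp add: induced_def)
    then show ?thesis unfolding Lm_def by (rule someI[of "induced P Q t"])
  qed
  \<comment> \<open>\<open>t\<close> and \<open>t'\<close> need only agree on the space of
    \<open>P\<close>. This is what makes the choice in \<open>Lm\<close> respect equality of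
    morphisms, and it yields the functor laws.\<close>
  have unique: "h y = h' y"
    if "group_ifun A P" "group_ifun A Q" "induced P Q t h" "induced P Q t' h'"
      "\<And>x. x \<in> topspace (tot P) \<Longrightarrow> t x = t' x" "y \<in> carrier (L P)" for P Q t t' h h' y
    by (rule universal_cone_hom_eq[OF univ[OF that(1)] L(1)[OF that(2)]])
      (use that(3-6) in \<open>auto simp: induced_def\<close>)
  have Lm_mor: "induced P Q t (Lm P Q t)"
    if "group_ifun A P" "group_ifun A Q" "group_ifun_mor A P Q t" for P Q t
    by (rule Lm[OF that(1,2) cone_precomp[OF that(1,3) L(2)[OF that(2)]]])
  have "left_adjoint_to_Delta TYPE('p ample) A L Lm (\<lambda>P x. (d P x, base P x))"
    unfolding left_adjoint_to_Delta_def
  proof (intro conjI allI impI ballI)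
    fix P :: "('o, 'm, 'p) igrp" assume P: "group_ifun A P"
    show "is_colimit TYPE('p ample) A P (L P) (\<lambda>x. (d P x, base P x))"
      using univ[OF P] by (simp add: is_colimit_iff[OF P] o_def)
    have "induced P P id id"
      using P by (simp add: induced_def pgrp_hom_def hom_def)
    moreover have "induced P P id (Lm P P id)"
      by (rule Lm[OF P P]) (simp add: L[OF P])
    ultimately show "Lm P P id y = y" if "y \<in> carrier (L P)" for y
      using unique[OF P P, of id "Lm P P id" id id y] that by simp
  next
    fix P Q :: "('o, 'm, 'p) igrp" and t
    assume *: "group_ifun A P \<and> group_ifun A Q \<and> group_ifun_mor A P Q t"
    with Lm_mor[of P Q t] show "pgrp_hom (L P) (L Q) (Lm P Q t)"
      by (simp add: induced_def)
    fix x assume "x \<in> topspace (tot P)"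
    with * Lm_mor[of P Q t] show "Delta_map (Lm P Q t) (d P x, base P x) = (d Q (t x), base Q (t x))"
      by (simp add: induced_def group_ifun_mor_def internal_nat_trans_def)
  next
    fix P Q :: "('o, 'm, 'p) igrp" and s t y
    assume "group_ifun A P \<and> group_ifun A Q \<and> group_ifun_mor A P Q s \<and> group_ifun_mor A P Q t \<and>
      (\<forall>x\<in>topspace (tot P). s x = t x)" and "y \<in> carrier (L P)"
    then show "Lm P Q s y = Lm P Q t y"
      using unique[OF _ _ Lm_mor Lm_mor] by blast
  next
    fix P Q R :: "('o, 'm, 'p) igrp" and s t y
    assume *: "group_ifun A P \<and> group_ifun A Q \<and> group_ifun A R \<and>
        group_ifun_mor A P Q s \<and> group_ifun_mor A Q R t" and y: "y \<in> carrier (L P)"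
    then have P: "group_ifun A P" and Q: "group_ifun A Q" and R: "group_ifun A R"
      and s: "group_ifun_mor A P Q s" and t: "group_ifun_mor A Q R t" by auto
    have "cone A P (L R) (\<lambda>x. d R ((t \<circ> s) x))"
      using cone_precomp[OF P s cone_precomp[OF Q t L(2)[OF R]]] by simp
    from Lm[OF P R this] have "induced P R (t \<circ> s) (Lm P R (t \<circ> s))" .
    moreover have "s x \<in> topspace (tot Q)" if "x \<in> topspace (tot P)" for x
      using s that continuous_map_image_subset_topspace[of "tot P" "tot Q" s]
      by (auto simp: group_ifun_mor_def internal_nat_trans_def)
    then have "induced P R (t \<circ> s) (Lm Q R t \<circ> Lm P Q s)"
      using Lm_mor[OF P Q s] Lm_mor[OF Q R t] pgrp_hom_comp by (auto simp: induced_def)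
    ultimately have "Lm P R (t \<circ> s) y = (Lm Q R t \<circ> Lm P Q s) y"
      by (rule unique[OF P R _ _ refl y])
    then show "Lm P R (t \<circ> s) y = Lm Q R t (Lm P Q s y)" by simp
  qed
  then show ?thesis by blast
qed

text \<open>Only the first clause of \<open>left_adjoint_to_Delta\<close> mentions the test type. It
  transfers with identities as injections, because the values of \<open>L\<close> already live over
  \<open>'p ample\<close>; the functoriality clauses are kept as they are.\<close>

lemma PGrp_has_internal_colimits: "PGrp_has_internal_colimits TYPE('o) TYPE('m) TYPE('p) TYPE('g)"
  unfolding PGrp_has_internal_colimits_def
proof (intro allI impI conjI left_adjoint_to_Delta_exists)
  fix A :: "('o, 'm) icat" and L :: "('o, 'm, 'p) igrp \<Rightarrow> 'p ample pgrp" and Lm \<eta>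
  assume *: "left_adjoint_to_Delta TYPE('p ample) A L Lm \<eta>"
  have "\<forall>P. group_ifun A P \<longrightarrow> is_colimit TYPE('g) A P (L P) (\<eta> P)"
    using conjunct1[OF *[unfolded left_adjoint_to_Delta_def]]
      is_colimit_transfer[OF _ _ inj_on_id inj_on_id, where 'g='g] by blast
  from conjI[OF this conjunct2[OF *[unfolded left_adjoint_to_Delta_def]]]
  show "left_adjoint_to_Delta TYPE('g) A L Lm \<eta>"
    unfolding left_adjoint_to_Delta_def .
qed

section \<open>Colimits as coequalisers of free products\<close>

lemma colimit_construction_exists:
  fixes A :: "('o, 'm) icat" and P :: "('o, 'm, 'p) igrp"
  assumes A: "internal_category A" and P: "group_ifun A P"
  shows "\<exists>(S0 :: 'p ample pgrp) \<iota>0 (S1 :: ('m \<times> 'p) ample pgrp) \<iota>1 u v (C :: 'p ample pgrp) q.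
    colimit_construction TYPE('g) A P S0 \<iota>0 S1 \<iota>1 u v C q"
proof -
  note P0 = group_ifun_ob_family[OF P] and P1 = group_ifun_arr_family[OF A P]
  obtain S0 :: "'p ample pgrp" and d0
    where S0: "universal_cone TYPE('p ample) (discrete_icat (Ob A)) (ob_family P) S0 d0"
    using universal_cone_exists[OF P0] by blast
  obtain S1 :: "('m \<times> 'p) ample pgrp" and d1
    where S1: "universal_cone TYPE(('m \<times> 'p) ample) (discrete_icat (Arr A)) (arr_family A P) S1 d1"
    using universal_cone_exists[OF P1] by blast
  obtain C :: "'p ample pgrp" and d where C: "universal_cone TYPE('p ample) A P C d"
    using universal_cone_exists[OF P] by blast
  have S0': "universal_cone TYPE('g) (discrete_icat (Ob A)) (ob_family P) S0 d0"
    by (rule universal_cone_transfer[OF P0 S0 inj_on_id inj_on_id])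
  \<comment> \<open>\<open>u\<close> and \<open>v\<close> end in a group over
    \<open>'p ample\<close>, whereas \<open>S1\<close> was obtained with the test type
    \<open>('m \<times> 'p) ample\<close>.\<close>
  have S1': "universal_cone TYPE('p ample) (discrete_icat (Arr A)) (arr_family A P) S1 d1"
    "universal_cone TYPE('g) (discrete_icat (Arr A)) (arr_family A P) S1 d1"
    by (rule universal_cone_transfer[OF P1 S1 inj_on_id inj_on_id])+
  have C': "universal_cone TYPE('g) A P C d"
    by (rule universal_cone_transfer[OF P C inj_on_id inj_on_id])
  have g0: "profinite_group S0" and d0: "cone (discrete_icat (Ob A)) (ob_family P) S0 d0"
    using S0 by (auto simp: universal_cone_def)
  have g1: "profinite_group S1" and d1: "cone (discrete_icat (Arr A)) (arr_family A P) S1 d1"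
    using S1 by (auto simp: universal_cone_def)
  have gC: "profinite_group C" and d: "cone A P C d"
    using C by (auto simp: universal_cone_def)
  obtain u where u: "pgrp_hom S1 S0 u"
      "\<And>z. z \<in> topspace (tot (arr_family A P)) \<Longrightarrow> u (d1 z) = d0 (snd z)"
    using universal_coneE[OF S1'(1) g0 cone_arr_family(1)[OF A P d0]] by blast
  obtain v where v: "pgrp_hom S1 S0 v"
      "\<And>z. z \<in> topspace (tot (arr_family A P)) \<Longrightarrow> v (d1 z) = d0 (act P z)"
    using universal_coneE[OF S1'(1) g0 cone_arr_family(2)[OF A P d0]] by blast
  \<comment> \<open>The universal cone on \<open>P\<close> is in particular a cone on the family
    over the objects, and so factors through \<open>S0\<close>.\<close>
  obtain q where q: "pgrp_hom S0 C q" "\<And>x. x \<in> topspace (tot P) \<Longrightarrow> q (d0 x) = d x"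
    using universal_coneE[OF S0 gC, of d] d by (auto simp: cone_ob_family_iff[OF A P])
  have q_uv: "q (u r) = q (v r)" if "r \<in> carrier S1" for r
  proof -
    \<comment> \<open>On \<open>d1 (f, x)\<close> the two sides are \<open>d x\<close> and
      \<open>d (act P (f, x))\<close>, which are equal because \<open>d\<close> is a cone.\<close>
    have "(q \<circ> u) r = (q \<circ> v) r"
      by (rule universal_cone_hom_eq[OF S1'(1) gC pgrp_hom_comp[OF u(1) q(1)] pgrp_hom_comp[OF v(1) q(1)] _ that])
        (use d in \<open>auto simp: u(2) v(2) q(2) act_closed[OF A P] cone_def\<close>)
    then show ?thesis by simp
  qed
  have "cone A P C (\<lambda>x. q (d0 x))"
    by (rule cone_coequalising[OF A P u(1) v(1) _ g0 d0 g1 d1 q(1) q_uv]) (auto simp: u(2) v(2))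
  then have Cq: "universal_cone TYPE('g) A P C (\<lambda>x. q (d0 x))"
    using C' by (simp add: universal_cone_def q(2))
  have "is_coequaliser TYPE('g) S1 S0 u v C q"
    by (rule is_coequaliser_of_universal_cone[OF A P u(1) v(1) _ S0' g1 d1 Cq q(1) q_uv])
      (auto simp: u(2) v(2))
  then have "colimit_construction TYPE('g) A P S0 (\<lambda>x. (d0 x, base P x)) S1 (\<lambda>z. (d1 z, fst z)) u v C q"
    using S0' S1'(2) u v
    by (auto simp: colimit_construction_def is_free_product_def is_colimit_iff[OF P0] is_colimit_iff[OF P1] o_def)
  then show ?thesis by blast
qed

lemma colimit_construction_is_colimit:
  fixes A :: "('o, 'm) icat" and P :: "('o, 'm, 'p) igrp" and U :: "'g itself"
  assumes A: "internal_category A" and P: "group_ifun A P"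
    and cc: "colimit_construction TYPE('g) A P S0 \<iota>0 S1 \<iota>1 u v C q"
  shows "is_colimit TYPE('g) A P C (Delta_map q \<circ> \<iota>0)"
proof -
  note P0 = group_ifun_ob_family[OF P] and P1 = group_ifun_arr_family[OF A P]
  have "universal_cone TYPE('g) A P C (\<lambda>x. q ((fst \<circ> \<iota>0) x))"
    by (rule universal_cone_of_coequaliser[OF A P, where ?d0.0="fst \<circ> \<iota>0" and ?d1.0="fst \<circ> \<iota>1" and ?S1.0=S1 and u=u and v=v])
      (use cc in \<open>auto simp: colimit_construction_def is_free_product_def is_colimit_iff[OF P0] is_colimit_iff[OF P1]\<close>)
  moreover have "snd (\<iota>0 x) = base P x" if "x \<in> topspace (tot P)" for x
    using cc that by (auto simp: colimit_construction_def is_free_product_def is_colimit_iff[OF P0])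
  ultimately show ?thesis by (simp add: is_colimit_iff[OF P] o_def)
qed

text \<open>The type \<open>('m \<times> 'p) ample\<close> has room for the elements of
  \<open>S0\<close>, \<open>S1\<close> and \<open>C\<close>, so both free products and the colimit
  transfer. Coequalisers are not transferred directly: the property is recovered from
  \<open>C\<close> being a colimit over the new test type.\<close>

lemma colimit_construction_transfer:
  fixes A :: "('o, 'm) icat" and P :: "('o, 'm, 'p) igrp"
    and S0 :: "'p ample pgrp" and S1 :: "('m \<times> 'p) ample pgrp" and C :: "'p ample pgrp"
  assumes A: "internal_category A" and P: "group_ifun A P"
    and cc: "colimit_construction TYPE(('m \<times> 'p) ample) A P S0 \<iota>0 S1 \<iota>1 u v C q"
  shows "colimit_construction TYPE('g) A P S0 \<iota>0 S1 \<iota>1 u v C q"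
proof -
  note P0 = group_ifun_ob_family[OF P] and P1 = group_ifun_arr_family[OF A P]
  \<comment> \<open>Any fixed first coordinate embeds \<open>'p\<close> into
    \<open>'m \<times> 'p\<close>.\<close>
  obtain j :: "'p ample \<Rightarrow> ('m \<times> 'p) ample" where j: "inj j"
    using inj_ample_map[of "Pair undefined"] by (auto simp: inj_def)
  have S0: "is_colimit TYPE('g) (discrete_icat (Ob A)) (ob_family P) S0 \<iota>0"
    and S1: "is_colimit TYPE('g) (discrete_icat (Arr A)) (arr_family A P) S1 \<iota>1"
    and C: "is_colimit TYPE('g) A P C (Delta_map q \<circ> \<iota>0)"
    using cc is_colimit_transfer[OF P0 _ j j] is_colimit_transfer[OF P1 _ inj_on_id inj_on_id]
      is_colimit_transfer[OF P colimit_construction_is_colimit[OF A P cc] j j]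
    by (auto simp: colimit_construction_def is_free_product_def)
  have "is_coequaliser TYPE('g) S1 S0 u v C q"
    by (rule is_coequaliser_of_universal_cone[OF A P, where ?d0.0="fst \<circ> \<iota>0" and ?d1.0="fst \<circ> \<iota>1"])
      (use cc S0 S1 C in \<open>auto simp: colimit_construction_def is_coequaliser_def universal_cone_def o_def
        is_colimit_iff[OF P0] is_colimit_iff[OF P1] is_colimit_iff[OF P]\<close>)
  then show ?thesis
    using cc S0 S1 by (simp add: colimit_construction_def is_free_product_def)
qed

theorem theorem2p3:
  fixes A :: "('o, 'm) icat" and P :: "('o, 'm, 'p) igrp"
  assumes "internal_category A" and "group_ifun A P"
  shows
    "(\<exists>(S0 :: 'p ample pgrp) \<iota>0 (S1 :: ('m \<times> 'p) ample pgrp) \<iota>1 u v (C :: 'p ample pgrp) q.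
        colimit_construction TYPE(('m \<times> 'p) ample) A P S0 \<iota>0 S1 \<iota>1 u v C q \<and>
        is_colimit TYPE(('m \<times> 'p) ample) A P C (Delta_map q \<circ> \<iota>0)) \<and>
     (\<forall>(S0 :: 'p ample pgrp) \<iota>0 (S1 :: ('m \<times> 'p) ample pgrp) \<iota>1 u v (C :: 'p ample pgrp) q.
        colimit_construction TYPE(('m \<times> 'p) ample) A P S0 \<iota>0 S1 \<iota>1 u v C q \<longrightarrow>
        colimit_construction TYPE('g) A P S0 \<iota>0 S1 \<iota>1 u v C q \<and>
        is_colimit TYPE('g) A P C (Delta_map q \<circ> \<iota>0)) \<and>
     PGrp_has_internal_colimits TYPE('o) TYPE('m) TYPE('p) TYPE('g)"
proof (intro conjI allI impI PGrp_has_internal_colimits)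
  show "\<exists>(S0 :: 'p ample pgrp) \<iota>0 (S1 :: ('m \<times> 'p) ample pgrp) \<iota>1 u v (C :: 'p ample pgrp) q.
        colimit_construction TYPE(('m \<times> 'p) ample) A P S0 \<iota>0 S1 \<iota>1 u v C q \<and>
        is_colimit TYPE(('m \<times> 'p) ample) A P C (Delta_map q \<circ> \<iota>0)"
    using colimit_construction_exists[OF assms, where 'g="('m \<times> 'p) ample"]
      colimit_construction_is_colimit[OF assms, where 'g="('m \<times> 'p) ample"] by blast
next
  fix S0 :: "'p ample pgrp" and \<iota>0 and S1 :: "('m \<times> 'p) ample pgrp" and \<iota>1 u v
    and C :: "'p ample pgrp" and q
  assume "colimit_construction TYPE(('m \<times> 'p) ample) A P S0 \<iota>0 S1 \<iota>1 u v C q"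
  then show "colimit_construction TYPE('g) A P S0 \<iota>0 S1 \<iota>1 u v C q"
    by (rule colimit_construction_transfer[OF assms])
  then show "is_colimit TYPE('g) A P C (Delta_map q \<circ> \<iota>0)"
    by (rule colimit_construction_is_colimit[OF assms])
qed

end
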